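(* Let $K$ be a field, let $\Gamma=(E,V,s,t)$ be a finite digraph, let $(\Gamma,\Pi)$ be a separated graph, and let $\Lambda\subseteq\Pi$. Let $L=CL_K(\Gamma,\Pi,\Lambda)$ be the separated Cohn-Leavitt path algebra of $(\Gamma,\Pi,\Lambda)$, let $\Omega=V\sqcup(\Pi\setminus\Lambda)$, and let $\alpha\in L$ be an idempotent of the form $\alpha=\sum_{v\in H}v$ where $H$ is a subset of $V$. If $\alpha=\sum_{v\in H}v$, regarded as an element of $\mathbb{Q}\Omega$, is not in the $\mathbb{Q}$-span of $\{\,sX-\sum_{e\in X}t(e)\,\}_{X\in\Lambda}$ in $\mathbb{Q}\Omega$, then the corner ring $\alpha L\alpha$ has IBN.
   Context: A digraph $\Gamma=(E,V,s,t)$ has vertex set $V$, edge set $E$, and source and target functions $s,t:E\to V$; it is finite if $V$ and $E$ are finite. A sink is a vertex $v$ with $s^{-1}(v)=\emptyset$. A separated graph $(\Gamma,\Pi)$ is a digraph $\Gamma$ together with a partition $\Pi$ of $E$ (into nonempty blocks) which is finer than (possibly equal to) $\{s^{-1}(v)\mid v\in V,\ v\text{ not a sink}\}$. Thus all edges in a block $X\in\Pi$ have the same source, denoted $sX$. For $\Lambda\subseteq\Pi$, the separated Cohn-Leavitt path algebra $CL_K(\Gamma,\Pi,\Lambda)$ over the field $K$ is the $K$-algebra generated by $\{v\mid v\in V\}\cup\{e,e^*\mid e\in E\}$ subject to the relations: (V) $vw=\delta_{v,w}v$ for all $v,w\in V$; (E1) $s(e)e=e\,t(e)=e$ for all $e\in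 E$; (E2) $t(e)e^*=e^*s(e)=e^*$ for all $e\in E$; (CK1) for all $X\in\Pi$, $e^*f=\delta_{e,f}\,t(e)$ for all $e,f\in X$; (CK2) for all $X\in\Lambda$, $sX=\sum_{e\in X}ee^*$. Since $V$ is finite, this algebra is unital with $1=\sum_{v\in V}v$. $\mathbb{Q}\Omega$ is the $\mathbb{Q}$-vector space with basis $\Omega$. For an idempotent $\alpha\in L$, the corner ring $\alpha L\alpha$ is a ring with unit $\alpha$. A unital ring $R$ has IBN (Invariant Basis Number) if $R^m\not\cong R^{m'}$ as right $R$-modules for all distinct positive integers $m\neq m'$. *)

theory Defs
  imports
    "HOL-Library.Poly_Mapping"
    "HOL-Library.Disjoint_Sets"
    "HOL-Algebra.QuotRing"
    "Graph_Theory.Digraph"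
begin

section \<open>Separated graphs\<close>

text \<open>Sources and targets of edges are \<^const>\<open>tail\<close> and \<^const>\<open>head\<close>; loops and multiple
  edges are allowed. Sinks are exactly the vertices with no outgoing arcs.\<close>

definition separated_graph :: "('v, 'e) pre_digraph \<Rightarrow> 'e set set \<Rightarrow> bool" where
  "separated_graph G \<P> \<longleftrightarrow>
     wf_digraph G \<and>
     refines (arcs G) \<P> {out_arcs G v | v. v \<in> verts G \<and> out_arcs G v \<noteq> {}}"

text \<open>Meaningful for nonempty blocks all of whose arcs have the same source.\<close>

definition block_source :: "('v, 'e) pre_digraph \<Rightarrow> 'e set \<Rightarrow> 'v" where
  "block_source G X = (THE v. \<forall>e\<in>X. tail G e = v)"

lemma separated_graph_block_source:
  assumes "separated_graph G \<P>" "X \<in> \<P>" "e \<in> X"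
  shows "e \<in> arcs G" "block_source G X = tail G e" "block_source G X \<in> verts G"
proof -
  have P: "partition_on (arcs G) \<P>" and wf: "wf_digraph G"
    using assms(1) by (auto simp: separated_graph_def refines_def)
  show e: "e \<in> arcs G"
    using P assms by (auto simp: partition_on_def)
  obtain v where v: "X \<subseteq> out_arcs G v"
    using assms by (fastforce simp: separated_graph_def refines_def)
  hence *: "tail G f = v" if "f \<in> X" for f
    using that by (auto simp: out_arcs_def)
  have "block_source G X = v"
    unfolding block_source_def using * assms(3) by (intro the_equality) auto
  thus "block_source G X = tail G e"
    using * assms(3) by simp
  thus "block_source G X \<in> verts G"
    using wf_digraph.tail_in_verts[OF wf e] by simp
qed

lemma block_source_in_verts:
  assumes "separated_graph G \<P>" "X \<in> \<P>"
  shows "block_source G X \<in> verts G" "X \<subseteq> arcs G"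
proof -
  have "X \<noteq> {}"
    using assms by (auto simp: separated_graph_def refines_def partition_on_def)
  thus "block_source G X \<in> verts G" "X \<subseteq> arcs G"
    using separated_graph_block_source[OF assms] by auto
qed

section \<open>Free algebras\<close>

text \<open>Words form a monoid, written additively so that finitely supported functions on words
  carry the convolution product of \<^theory>\<open>HOL-Library.Poly_Mapping\<close>.\<close>

datatype 'g word = Word (letters: "'g list")

instantiation word :: (type) monoid_add
begin

definition zero_word :: "'a word" where "0 = Word []"

definition plus_word :: "'a word \<Rightarrow> 'a word \<Rightarrow> 'a word" where
  "u + w = Word (letters u @ letters w)"

instance
  by standard (auto simp: zero_word_def plus_word_def)

end

type_synonym ('g, 'k) ncpoly = "'g word \<Rightarrow>\<^sub>0 'k"

definition gen :: "'g \<Rightarrow> ('g, 'k::field) ncpoly" where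
  "gen g = Poly_Mapping.single (Word [g]) 1"

text \<open>The free unital associative algebra on the set \<open>S\<close>. Since it contains the scalars (as
  central elements), its ring ideals are the same as its algebra ideals.\<close>

definition free_algebra :: "'g set \<Rightarrow> ('g, 'k::field) ncpoly ring" where
  "free_algebra S =
     \<lparr>carrier = {p. \<forall>w \<in> Poly_Mapping.keys p. set (letters w) \<subseteq> S},
      mult = (*), one = 1, zero = 0, add = (+)\<rparr>"

text \<open>The linear span of the nonempty words: the free non-unital algebra on \<open>S\<close>.\<close>

definition free_algebra_plus :: "'g set \<Rightarrow> ('g, 'k::field) ncpoly set" where
  "free_algebra_plus S = {p \<in> carrier (free_algebra S). 0 \<notin> Poly_Mapping.keys p}"

lemma free_algebra_closed:
  fixes S :: "'g set"
  defines "A \<equiv> carrier (free_algebra S :: ('g, 'k::field) ncpoly ring)"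
  shows "p \<in> A \<Longrightarrow> q \<in> A \<Longrightarrow> p + q \<in> A" "p \<in> A \<Longrightarrow> q \<in> A \<Longrightarrow> p - q \<in> A"
    "p \<in> A \<Longrightarrow> q \<in> A \<Longrightarrow> p * q \<in> A" "p \<in> A \<Longrightarrow> - p \<in> A" "0 \<in> A" "1 \<in> A"
    "g \<in> S \<Longrightarrow> gen g \<in> A" "(\<And>i. i \<in> J \<Longrightarrow> h i \<in> A) \<Longrightarrow> sum h J \<in> A"
proof -
  show add: "p + q \<in> A" if "p \<in> A" "q \<in> A" for p q
    using that Poly_Mapping.keys_add[of p q] by (fastforce simp: A_def free_algebra_def)
  show u: "- p \<in> A" if "p \<in> A" for p
    using that by (auto simp: A_def free_algebra_def)
  show "p - q \<in> A" if "p \<in> A" "q \<in> A"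
    using add[OF that(1) u[OF that(2)]] by simp
  show "p * q \<in> A" if "p \<in> A" "q \<in> A"
    using that Poly_Mapping.keys_mult[of p q]
    by (fastforce simp: A_def free_algebra_def plus_word_def)
  show z: "0 \<in> A" "1 \<in> A"
    by (auto simp: A_def free_algebra_def zero_word_def simp flip: single_one)
  show "gen g \<in> A" if "g \<in> S"
    using that by (auto simp: A_def free_algebra_def gen_def)
  show "sum h J \<in> A" if "\<And>i. i \<in> J \<Longrightarrow> h i \<in> A"
    using that by (induction J rule: infinite_finite_induct) (simp_all add: add z)
qed

lemma ring_free_algebra: "ring (free_algebra S :: ('g, 'k::field) ncpoly ring)"
proof -
  let ?A = "free_algebra S :: ('g, 'k) ncpoly ring"
  have A: "mult ?A = (*)" "add ?A = (+)" "one ?A = 1" "zero ?A = 0"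
    by (simp_all add: free_algebra_def)
  show ?thesis
  proof (intro ringI abelian_groupI monoidI; unfold A)
    fix x assume "x \<in> carrier ?A"
    thus "\<exists>y\<in>carrier ?A. y + x = 0"
      by (intro bexI[of _ "- x"]) (simp_all add: free_algebra_closed)
  qed (simp_all add: free_algebra_closed algebra_simps)
qed

section \<open>Separated Cohn-Leavitt path algebras\<close>

datatype ('v, 'e) cl_gen = Vert 'v | Edge 'e | Ghost 'e

definition cl_gens :: "('v, 'e) pre_digraph \<Rightarrow> ('v, 'e) cl_gen set" where
  "cl_gens G = Vert ` verts G \<union> Edge ` arcs G \<union> Ghost ` arcs G"

text \<open>Each relation \<open>p = q\<close> is represented by \<open>p - q\<close>.\<close>

definition cl_relators ::
  "('v, 'e) pre_digraph \<Rightarrow> 'e set set \<Rightarrow> 'e set set \<Rightarrow> (('v, 'e) cl_gen, 'k::field) ncpoly set"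
  where "cl_relators G \<P> \<Lambda> =
    \<comment> \<open>(V)\<close>
    {gen (Vert v) * gen (Vert w) - (if v = w then gen (Vert v) else 0) | v w.
       v \<in> verts G \<and> w \<in> verts G} \<union>
    \<comment> \<open>(E1)\<close>
    {gen (Vert (tail G e)) * gen (Edge e) - gen (Edge e) | e. e \<in> arcs G} \<union>
    {gen (Edge e) * gen (Vert (head G e)) - gen (Edge e) | e. e \<in> arcs G} \<union>
    \<comment> \<open>(E2)\<close>
    {gen (Vert (head G e)) * gen (Ghost e) - gen (Ghost e) | e. e \<in> arcs G} \<union>
    {gen (Ghost e) * gen (Vert (tail G e)) - gen (Ghost e) | e. e \<in> arcs G} \<union>
    \<comment> \<open>(CK1)\<close>
    {gen (Ghost e) * gen (Edge f) - (if e = f then gen (Vert (head G e)) else 0) | e f X.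
       X \<in> \<P> \<and> e \<in> X \<and> f \<in> X} \<union>
    \<comment> \<open>(CK2)\<close>
    {gen (Vert (block_source G X)) - (\<Sum>e\<in>X. gen (Edge e) * gen (Ghost e)) | X. X \<in> \<Lambda>}"

definition cl_ideal ::
  "('v, 'e) pre_digraph \<Rightarrow> 'e set set \<Rightarrow> 'e set set \<Rightarrow> (('v, 'e) cl_gen, 'k::field) ncpoly set"
  where "cl_ideal G \<P> \<Lambda> = Idl\<^bsub>free_algebra (cl_gens G)\<^esub> (cl_relators G \<P> \<Lambda>)"

definition cl_class ::
  "('v, 'e) pre_digraph \<Rightarrow> 'e set set \<Rightarrow> 'e set set \<Rightarrow>
   (('v, 'e) cl_gen, 'k::field) ncpoly \<Rightarrow> (('v, 'e) cl_gen, 'k) ncpoly set"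
  where "cl_class G \<P> \<Lambda> p = cl_ideal G \<P> \<Lambda> +>\<^bsub>free_algebra (cl_gens G)\<^esub> p"

text \<open>The presentation is one of algebras without a prescribed unit, so the algebra is the
  quotient of the free non-unital algebra; it is cut out of the quotient of the free unital
  algebra by the same ideal (all relators lie in the non-unital part). The unit is the sum of the
  vertices, not the class of the empty word; see \<open>ring_CL\<close>.\<close>

definition CL ::
  "('v, 'e) pre_digraph \<Rightarrow> 'e set set \<Rightarrow> 'e set set \<Rightarrow> (('v, 'e) cl_gen, 'k::field) ncpoly set ring"
  where "CL G \<P> \<Lambda> =
    (free_algebra (cl_gens G) Quot cl_ideal G \<P> \<Lambda>)
      \<lparr>carrier := cl_class G \<P> \<Lambda> ` free_algebra_plus (cl_gens G),
       one := cl_class G \<P> \<Lambda> (\<Sum>v\<in>verts G. gen (Vert v))\<rparr>"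

definition cl_vert ::
  "('v, 'e) pre_digraph \<Rightarrow> 'e set set \<Rightarrow> 'e set set \<Rightarrow> 'v \<Rightarrow> (('v, 'e) cl_gen, 'k::field) ncpoly set"
  where "cl_vert G \<P> \<Lambda> v = cl_class G \<P> \<Lambda> (gen (Vert v))"

lemma cl_relators_closed:
  assumes "separated_graph G \<P>" "\<Lambda> \<subseteq> \<P>"
  shows "cl_relators G \<P> \<Lambda> \<subseteq> carrier (free_algebra (cl_gens G) :: (_, 'k::field) ncpoly ring)"
    (is "_ \<subseteq> ?A")
proof -
  have wf: "wf_digraph G"
    using assms by (simp add: separated_graph_def)
  have *: "Vert v \<in> cl_gens G \<longleftrightarrow> v \<in> verts G" "Edge e \<in> cl_gens G \<longleftrightarrow> e \<in> arcs G"
    "Ghost e \<in> cl_gens G \<longleftrightarrow> e \<in> arcs G" for v e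
    by (auto simp: cl_gens_def)
  have g: "v \<in> verts G \<Longrightarrow> gen (Vert v) \<in> ?A" "e \<in> arcs G \<Longrightarrow> gen (Edge e) \<in> ?A"
    "e \<in> arcs G \<Longrightarrow> gen (Ghost e) \<in> ?A" for v e
    by (intro free_algebra_closed(7); simp add: *)+
  note X = block_source_in_verts[OF assms(1)]
    and wf = wf_digraph.tail_in_verts[OF wf] wf_digraph.head_in_verts[OF wf]
  have "e \<in> arcs G" if "X \<in> \<P>" "e \<in> X" for X e
    using X that by blast
  moreover have "gen (Vert (block_source G X)) \<in> ?A"
      "(\<Sum>e\<in>X. gen (Edge e) * gen (Ghost e)) \<in> ?A" if "X \<in> \<Lambda>" for X
    using X[of X] that assms(2) by (auto intro!: free_algebra_closed(3,8) g)
  ultimately show ?thesis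
    unfolding cl_relators_def
    by (intro Un_least; clarify; intro free_algebra_closed(2); simp add: g wf free_algebra_closed)
qed

lemma cl_ideal:
  assumes "separated_graph G \<P>" "\<Lambda> \<subseteq> \<P>"
  shows "ideal (cl_ideal G \<P> \<Lambda>) (free_algebra (cl_gens G) :: (_, 'k::field) ncpoly ring)"
  unfolding cl_ideal_def
  by (intro ring.genideal_ideal ring_free_algebra cl_relators_closed assms)

lemma cl_ideal_closed:
  fixes G :: "('v, 'e) pre_digraph" and A :: "(('v, 'e) cl_gen, 'k::field) ncpoly ring"
  assumes "separated_graph G \<P>" "\<Lambda> \<subseteq> \<P>"
  defines "I \<equiv> cl_ideal G \<P> \<Lambda>" and "A \<equiv> free_algebra (cl_gens G)"
  shows "p \<in> I \<Longrightarrow> q \<in> I \<Longrightarrow> p + q \<in> I" "0 \<in> I"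
    "p \<in> I \<Longrightarrow> a \<in> carrier A \<Longrightarrow> a * p \<in> I" "p \<in> I \<Longrightarrow> a \<in> carrier A \<Longrightarrow> p * a \<in> I"
    "p \<in> I \<Longrightarrow> - p \<in> I" "p \<in> I \<Longrightarrow> q \<in> I \<Longrightarrow> p - q \<in> I"
    "(\<And>i. i \<in> J \<Longrightarrow> h i \<in> I) \<Longrightarrow> sum h J \<in> I"
proof -
  interpret ideal I A
    unfolding I_def A_def by (rule cl_ideal[OF assms(1,2)])
  show add: "p + q \<in> I" if "p \<in> I" "q \<in> I" for p q
    using additive_subgroup.a_closed[OF additive_subgroup_axioms that]
    by (simp add: A_def free_algebra_def)
  show z: "0 \<in> I"
    using additive_subgroup.zero_closed[OF additive_subgroup_axioms]
    by (simp add: A_def free_algebra_def)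
  show mult: "a * p \<in> I" "p * a \<in> I" if "p \<in> I" "a \<in> carrier A" for p a
    using I_l_closed[OF that] I_r_closed[OF that] by (simp_all add: A_def free_algebra_def)
  have "- 1 \<in> carrier A"
    unfolding A_def by (intro free_algebra_closed)
  thus u: "- p \<in> I" if "p \<in> I" for p
    using mult[OF that, of "- 1"] by simp
  show "p - q \<in> I" if "p \<in> I" "q \<in> I"
    using add[OF that(1) u[OF that(2)]] by simp
  show "sum h J \<in> I" if "\<And>i. i \<in> J \<Longrightarrow> h i \<in> I"
    using that by (induction J rule: infinite_finite_induct) (simp_all add: add z)
qed

lemma cl_class_hom:
  assumes "separated_graph G \<P>" "\<Lambda> \<subseteq> \<P>"
  shows "(cl_class G \<P> \<Lambda> :: (_, 'k::field) ncpoly \<Rightarrow> _) \<in>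
    ring_hom (free_algebra (cl_gens G)) (free_algebra (cl_gens G) Quot cl_ideal G \<P> \<Lambda>)"
  using ideal.rcos_ring_hom[OF cl_ideal[OF assms]] by (simp add: cl_class_def[abs_def])

lemma cl_class_eq_iff:
  fixes p q :: "(_, 'k::field) ncpoly"
  assumes "separated_graph G \<P>" "\<Lambda> \<subseteq> \<P>"
    and "p \<in> carrier (free_algebra (cl_gens G))" "q \<in> carrier (free_algebra (cl_gens G))"
  shows "cl_class G \<P> \<Lambda> p = cl_class G \<P> \<Lambda> q \<longleftrightarrow> p - q \<in> cl_ideal G \<P> \<Lambda>"
proof -
  let ?A = "free_algebra (cl_gens G) :: (_, 'k) ncpoly ring"
  interpret ideal "cl_ideal G \<P> \<Lambda>" ?A
    by (rule cl_ideal[OF assms(1,2)])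
  have "\<ominus>\<^bsub>?A\<^esub> q = - q"
    by (rule minus_equality[symmetric, THEN sym])
      (use assms(4) free_algebra_closed(4)[OF assms(4)] in \<open>simp_all add: free_algebra_def\<close>)
  hence "p \<ominus>\<^bsub>?A\<^esub> q = p - q"
    by (simp add: a_minus_def) (simp add: free_algebra_def)
  thus ?thesis
    using quotient_eq_iff_same_a_r_cos[OF ideal_axioms assms(3,4)] by (simp add: cl_class_def)
qed

lemma cl_unit:
  fixes p :: "(_, 'k::field) ncpoly"
  assumes "fin_digraph G" "separated_graph G \<P>" "\<Lambda> \<subseteq> \<P>"
    and p: "p \<in> free_algebra_plus (cl_gens G)"
  defines "u \<equiv> \<Sum>v\<in>verts G. gen (Vert v)"
  shows "u * p - p \<in> cl_ideal G \<P> \<Lambda>" "p * u - p \<in> cl_ideal G \<P> \<Lambda>"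
proof -
  let ?A = "free_algebra (cl_gens G) :: (_, 'k) ncpoly ring"
  let ?I = "cl_ideal G \<P> \<Lambda> :: (_, 'k) ncpoly set"
  note I = cl_ideal_closed[OF assms(2,3), where 'k = 'k]
  interpret fin_digraph G by fact
  have R: "cl_relators G \<P> \<Lambda> \<subseteq> ?I"
    unfolding cl_ideal_def
    by (rule ring.genideal_self[OF ring_free_algebra cl_relators_closed[OF assms(2,3)]])
  have cg: "Vert v \<in> cl_gens G \<longleftrightarrow> v \<in> verts G" "Edge e \<in> cl_gens G \<longleftrightarrow> e \<in> arcs G"
    "Ghost e \<in> cl_gens G \<longleftrightarrow> e \<in> arcs G" for v e
    by (auto simp: cl_gens_def)
  have uA: "u \<in> carrier ?A"
    unfolding u_def by (intro free_algebra_closed) (simp add: cg)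
  have vert: "u * gen (Vert v) - gen (Vert v) \<in> ?I" "gen (Vert v) * u - gen (Vert v) \<in> ?I"
    if v: "v \<in> verts G" for v
  proof -
    let ?d = "\<lambda>w. if w = v then gen (Vert v) else 0 :: (_, 'k) ncpoly"
    have "u * gen (Vert v) - gen (Vert v)
      = (\<Sum>w\<in>verts G. gen (Vert w) * gen (Vert v) - ?d w)"
      by (simp add: u_def sum_distrib_right sum_subtractf v)
    moreover have "gen (Vert v) * u - gen (Vert v)
      = (\<Sum>w\<in>verts G. gen (Vert v) * gen (Vert w) - ?d w)"
      by (simp add: u_def sum_distrib_left sum_subtractf v)
    moreover have "gen (Vert w) * gen (Vert v) - ?d w \<in> ?I"
      "gen (Vert v) * gen (Vert w) - ?d w \<in> ?I" if "w \<in> verts G" for w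
    proof -
      have *: "gen (Vert a) * gen (Vert b) - (if a = b then gen (Vert a) else 0) \<in> ?I"
        if "a \<in> verts G" "b \<in> verts G" for a b
        by (rule subsetD[OF R]) (use that in \<open>auto simp: cl_relators_def\<close>)
      show "gen (Vert w) * gen (Vert v) - ?d w \<in> ?I"
        using *[of w v] that v by (auto split: if_splits)
      show "gen (Vert v) * gen (Vert w) - ?d w \<in> ?I"
        using *[of v w] that v by (auto split: if_splits)
    qed
    ultimately show "u * gen (Vert v) - gen (Vert v) \<in> ?I" "gen (Vert v) * u - gen (Vert v) \<in> ?I"
      by (auto intro!: I(7))
  qed
  have left: "u * x - x \<in> ?I"
    if "gen (Vert v) * x - x \<in> ?I" "v \<in> verts G" "x \<in> carrier ?A" for v x
  proof -
    have "u * x - x = (u * gen (Vert v) - gen (Vert v)) * x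
        - u * (gen (Vert v) * x - x) + (gen (Vert v) * x - x)"
      by (simp add: algebra_simps)
    moreover have "(u * gen (Vert v) - gen (Vert v)) * x \<in> ?I" "u * (gen (Vert v) * x - x) \<in> ?I"
      by (rule I(4)[OF vert(1)[OF that(2)] that(3)], rule I(3)[OF that(1) uA])
    ultimately show ?thesis
      by (simp only: I(1,6) that(1))
  qed
  have right: "x * u - x \<in> ?I"
    if "x * gen (Vert v) - x \<in> ?I" "v \<in> verts G" "x \<in> carrier ?A" for v x
  proof -
    have "x * u - x = x * (gen (Vert v) * u - gen (Vert v))
        - (x * gen (Vert v) - x) * u + (x * gen (Vert v) - x)"
      by (simp add: algebra_simps)
    moreover have "x * (gen (Vert v) * u - gen (Vert v)) \<in> ?I" "(x * gen (Vert v) - x) * u \<in> ?I"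
      by (rule I(3)[OF vert(2)[OF that(2)] that(3)], rule I(4)[OF that(1) uA])
    ultimately show ?thesis
      by (simp only: I(1,6) that(1))
  qed
  have E: "gen (Vert (tail G e)) * gen (Edge e) - gen (Edge e) \<in> ?I"
    "gen (Edge e) * gen (Vert (head G e)) - gen (Edge e) \<in> ?I"
    "gen (Vert (head G e)) * gen (Ghost e) - gen (Ghost e) \<in> ?I"
    "gen (Ghost e) * gen (Vert (tail G e)) - gen (Ghost e) \<in> ?I" if "e \<in> arcs G" for e
    by (rule subsetD[OF R]; use that in \<open>auto simp: cl_relators_def\<close>)+
  have g: "u * gen g - gen g \<in> ?I \<and> gen g * u - gen g \<in> ?I" if "g \<in> cl_gens G" for g
  proof (cases g)
    case (Vert v)
    thus ?thesis using vert that by (auto simp: cg)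
  next
    case (Edge e)
    hence e: "e \<in> arcs G" using that by (simp add: cg)
    have "gen (Edge e) \<in> carrier ?A" by (intro free_algebra_closed) (simp add: cg e)
    thus ?thesis
      using left[OF E(1)[OF e]] right[OF E(2)[OF e]] e Edge by simp
  next
    case (Ghost e)
    hence e: "e \<in> arcs G" using that by (simp add: cg)
    have "gen (Ghost e) \<in> carrier ?A" by (intro free_algebra_closed) (simp add: cg e)
    thus ?thesis
      using left[OF E(3)[OF e]] right[OF E(4)[OF e]] e Ghost by simp
  qed
  have word: "u * Poly_Mapping.single w c - Poly_Mapping.single w c \<in> ?I \<and>
      Poly_Mapping.single w c * u - Poly_Mapping.single w c \<in> ?I"
    if w: "w \<noteq> 0" "set (letters w) \<subseteq> cl_gens G" for w and c :: 'k
  proof -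
    obtain gs where ws: "w = Word gs" "gs \<noteq> []"
      using w(1) by (cases w) (auto simp: zero_word_def)
    let ?s = "\<lambda>l. Poly_Mapping.single (Word l) c :: (_, 'k) ncpoly"
    have s: "?s l \<in> carrier ?A" if "set l \<subseteq> cl_gens G" for l
      using that by (auto simp: free_algebra_def)
    have 1: "Poly_Mapping.single w c = gen (hd gs) * ?s (tl gs)"
      using ws by (simp add: gen_def mult_single plus_word_def)
    have 2: "Poly_Mapping.single w c = ?s (butlast gs) * gen (last gs)"
      using ws by (simp add: gen_def mult_single plus_word_def)
    have "hd gs \<in> cl_gens G" "last gs \<in> cl_gens G" "set (tl gs) \<subseteq> cl_gens G"
        "set (butlast gs) \<subseteq> cl_gens G"
      using w ws hd_in_set[OF ws(2)] last_in_set[OF ws(2)]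
      by (auto dest: list.set_sel in_set_butlastD)
    hence "(u * gen (hd gs) - gen (hd gs)) * ?s (tl gs) \<in> ?I"
      "?s (butlast gs) * (gen (last gs) * u - gen (last gs)) \<in> ?I"
      using g s by (blast intro: I(4), blast intro: I(3))
    moreover have "(u * gen (hd gs) - gen (hd gs)) * ?s (tl gs)
        = u * Poly_Mapping.single w c - Poly_Mapping.single w c"
      unfolding 1 by (simp add: algebra_simps)
    moreover have "?s (butlast gs) * (gen (last gs) * u - gen (last gs))
        = Poly_Mapping.single w c * u - Poly_Mapping.single w c"
      unfolding 2 by (simp add: algebra_simps)
    ultimately show ?thesis by simp
  qed
  let ?K = "Poly_Mapping.keys p"
  let ?t = "\<lambda>w. Poly_Mapping.single w (Poly_Mapping.lookup p w)"
  have p_sum: "p = (\<Sum>w\<in>?K. ?t w)"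
    by (rule poly_mapping_eqI) (auto simp: lookup_sum lookup_single when_def in_keys_iff)
  have "u * p - p = (\<Sum>w\<in>?K. u * ?t w - ?t w)" "p * u - p = (\<Sum>w\<in>?K. ?t w * u - ?t w)"
    by (simp_all add: sum_subtractf flip: sum_distrib_left sum_distrib_right p_sum)
  moreover have "u * ?t w - ?t w \<in> ?I \<and> ?t w * u - ?t w \<in> ?I" if "w \<in> ?K" for w
    by (rule word) (use p that in \<open>auto simp: free_algebra_plus_def free_algebra_def\<close>)
  ultimately show "u * p - p \<in> ?I" "p * u - p \<in> ?I"
    by (auto intro!: I(7))
qed

lemma ring_CL:
  fixes G :: "('v, 'e) pre_digraph"
  assumes "fin_digraph G" "separated_graph G \<P>" "\<Lambda> \<subseteq> \<P>"
  shows "ring (CL G \<P> \<Lambda> :: (_, 'k::field) ncpoly set ring)"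
proof -
  let ?A = "free_algebra (cl_gens G) :: (_, 'k) ncpoly ring"
  let ?Q = "?A Quot cl_ideal G \<P> \<Lambda>"
  let ?L = "CL G \<P> \<Lambda> :: (_, 'k) ncpoly set ring"
  let ?c = "cl_class G \<P> \<Lambda> :: (_, 'k) ncpoly \<Rightarrow> _"
  let ?P = "free_algebra_plus (cl_gens G) :: (_, 'k) ncpoly set"
  let ?u = "\<Sum>v\<in>verts G. gen (Vert v) :: (_, 'k) ncpoly"
  interpret Q: ring ?Q
    by (rule ideal.quotient_is_ring[OF cl_ideal[OF assms(2,3)]])
  note hom = cl_class_hom[OF assms(2,3), where 'k = 'k]
  have PA: "?P \<subseteq> carrier ?A"
    by (auto simp: free_algebra_plus_def)
  have P: "p + q \<in> ?P" "p * q \<in> ?P" "- p \<in> ?P" "0 \<in> ?P" if "p \<in> ?P" "q \<in> ?P" for p q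
  proof -
    show "p + q \<in> ?P"
      using that Poly_Mapping.keys_add[of p q] free_algebra_closed(1)[of p _ q]
      by (auto simp: free_algebra_plus_def)
    have "0 \<notin> Poly_Mapping.keys (p * q)"
    proof
      assume "0 \<in> Poly_Mapping.keys (p * q)"
      then obtain a b where ab: "a + b = 0" "a \<in> Poly_Mapping.keys p"
        using Poly_Mapping.keys_mult[of p q] by (smt (verit) mem_Collect_eq subset_iff)
      hence "a = 0"
        by (cases a) (simp add: plus_word_def zero_word_def)
      thus False
        using ab that by (simp add: free_algebra_plus_def)
    qed
    thus "p * q \<in> ?P"
      using that free_algebra_closed(3)[of p _ q] by (auto simp: free_algebra_plus_def)
    show "- p \<in> ?P" "0 \<in> ?P"
      using that free_algebra_closed(4)[of p] by (auto simp: free_algebra_plus_def free_algebra_closed)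
  qed
  have gP: "gen g \<in> ?P" if "g \<in> cl_gens G" for g
    using that by (auto simp: free_algebra_plus_def free_algebra_def gen_def zero_word_def)
  have zP: "0 \<in> ?P"
    by (auto simp: free_algebra_plus_def free_algebra_closed)
  have uP: "?u \<in> ?P"
  proof -
    have "sum h J \<in> ?P" if "\<And>i. i \<in> J \<Longrightarrow> h i \<in> ?P" for h :: "'v \<Rightarrow> _" and J
      using that by (induction J rule: infinite_finite_induct) (simp_all add: P zP)
    thus ?thesis using gP by (simp add: cl_gens_def)
  qed
  have cQ: "?c p \<in> carrier ?Q" if "p \<in> ?P" for p
    using ring_hom_closed[OF hom] PA that by blast
  have c_add: "?c p \<oplus>\<^bsub>?Q\<^esub> ?c q = ?c (p + q)" if "p \<in> ?P" "q \<in> ?P" for p q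
    using ring_hom_add[OF hom, of p q] PA that by (auto simp: free_algebra_def)
  have c_mult: "?c p \<otimes>\<^bsub>?Q\<^esub> ?c q = ?c (p * q)" if "p \<in> ?P" "q \<in> ?P" for p q
    using ring_hom_mult[OF hom, of p q] PA that by (auto simp: free_algebra_def)
  have c_zero: "\<zero>\<^bsub>?Q\<^esub> = ?c 0"
    using ring_hom_zero[OF hom ring_free_algebra Q.ring_axioms] by (simp add: free_algebra_def)
  have L: "carrier ?L = ?c ` ?P" "mult ?L = mult ?Q" "add ?L = add ?Q" "zero ?L = zero ?Q"
    "one ?L = ?c ?u"
    by (simp_all add: CL_def FactRing_def)
  have unit: "?c (?u * p) = ?c p" "?c (p * ?u) = ?c p" if "p \<in> ?P" for p
    using cl_unit[OF assms that] PA P that uP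
    by (subst cl_class_eq_iff[OF assms(2,3)]; blast)+
  show ?thesis
  proof (intro ringI abelian_groupI monoidI)
    fix x assume "x \<in> carrier ?L"
    then obtain p where p: "x = ?c p" "p \<in> ?P" by (auto simp: L)
    show "\<exists>y\<in>carrier ?L. y \<oplus>\<^bsub>?L\<^esub> x = \<zero>\<^bsub>?L\<^esub>"
      by (intro bexI[of _ "?c (- p)"]) (use p in \<open>simp_all add: L c_add c_zero P\<close>)
  next
    fix x assume "x \<in> carrier ?L"
    then obtain p where "x = ?c p" "p \<in> ?P" by (auto simp: L)
    thus "\<one>\<^bsub>?L\<^esub> \<otimes>\<^bsub>?L\<^esub> x = x" "x \<otimes>\<^bsub>?L\<^esub> \<one>\<^bsub>?L\<^esub> = x"
      by (simp_all add: L c_mult uP unit)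
  next
    fix x y z assume "x \<in> carrier ?L" "y \<in> carrier ?L" "z \<in> carrier ?L"
    then obtain p q r where "x = ?c p" "y = ?c q" "z = ?c r" "p \<in> ?P" "q \<in> ?P" "r \<in> ?P"
      by (auto simp: L)
    thus "x \<oplus>\<^bsub>?L\<^esub> y \<oplus>\<^bsub>?L\<^esub> z = x \<oplus>\<^bsub>?L\<^esub> (y \<oplus>\<^bsub>?L\<^esub> z)"
      "x \<otimes>\<^bsub>?L\<^esub> y \<otimes>\<^bsub>?L\<^esub> z = x \<otimes>\<^bsub>?L\<^esub> (y \<otimes>\<^bsub>?L\<^esub> z)"
      "(x \<oplus>\<^bsub>?L\<^esub> y) \<otimes>\<^bsub>?L\<^esub> z = x \<otimes>\<^bsub>?L\<^esub> z \<oplus>\<^bsub>?L\<^esub> y \<otimes>\<^bsub>?L\<^esub> z"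
      "z \<otimes>\<^bsub>?L\<^esub> (x \<oplus>\<^bsub>?L\<^esub> y) = z \<otimes>\<^bsub>?L\<^esub> x \<oplus>\<^bsub>?L\<^esub> z \<otimes>\<^bsub>?L\<^esub> y"
      by (simp_all add: L c_add c_mult P algebra_simps)
  next
    fix x y assume "x \<in> carrier ?L" "y \<in> carrier ?L"
    then obtain p q where "x = ?c p" "y = ?c q" "p \<in> ?P" "q \<in> ?P" by (auto simp: L)
    thus "x \<oplus>\<^bsub>?L\<^esub> y \<in> carrier ?L" "x \<otimes>\<^bsub>?L\<^esub> y \<in> carrier ?L" "x \<oplus>\<^bsub>?L\<^esub> y = y \<oplus>\<^bsub>?L\<^esub> x"
      by (auto simp: L c_add c_mult P add.commute)
  next
    fix x assume "x \<in> carrier ?L"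
    thus "\<zero>\<^bsub>?L\<^esub> \<oplus>\<^bsub>?L\<^esub> x = x" by (auto simp: L cQ)
  qed (auto simp: L c_zero zP uP)
qed

section \<open>The rational vector space\<close>

definition rat_scale :: "rat \<Rightarrow> ('b \<Rightarrow>\<^sub>0 rat) \<Rightarrow> ('b \<Rightarrow>\<^sub>0 rat)" where
  "rat_scale c p = Poly_Mapping.map ((*) c) p"

lemma lookup_rat_scale [simp]:
  "Poly_Mapping.lookup (rat_scale c p) b = c * Poly_Mapping.lookup p b"
  by (simp add: rat_scale_def Poly_Mapping.map.rep_eq when_def)

lemma vector_space_rat_scale: "vector_space rat_scale"
  by standard (rule poly_mapping_eqI; simp add: lookup_add algebra_simps)+

definition rat_space :: "'b set \<Rightarrow> ('b \<Rightarrow>\<^sub>0 rat) set" where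
  "rat_space B = {p. Poly_Mapping.keys p \<subseteq> B}"

definition Omega :: "('v, 'e) pre_digraph \<Rightarrow> 'e set set \<Rightarrow> 'e set set \<Rightarrow> ('v + 'e set) set" where
  "Omega G \<P> \<Lambda> = verts G <+> (\<P> - \<Lambda>)"

definition vert_basis :: "'v \<Rightarrow> ('v + 'e set \<Rightarrow>\<^sub>0 rat)" where
  "vert_basis v = Poly_Mapping.single (Inl v) 1"

definition block_vector :: "('v, 'e) pre_digraph \<Rightarrow> 'e set \<Rightarrow> ('v + 'e set \<Rightarrow>\<^sub>0 rat)" where
  "block_vector G X = vert_basis (block_source G X) - (\<Sum>e\<in>X. vert_basis (head G e))"

section \<open>Corner rings and invariant basis number\<close>

definition corner_ring :: "('a, 'm) ring_scheme \<Rightarrow> 'a \<Rightarrow> ('a, 'm) ring_scheme" where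
  "corner_ring R a =
     R\<lparr>carrier := {a \<otimes>\<^bsub>R\<^esub> x \<otimes>\<^bsub>R\<^esub> a | x. x \<in> carrier R}, one := a\<rparr>"

lemma ring_corner_ring:
  fixes R (structure)
  assumes "ring R" "a \<in> carrier R" "a \<otimes>\<^bsub>R\<^esub> a = a"
  shows "ring (corner_ring R a)"
proof -
  interpret ring R by fact
  let ?C = "{x \<in> carrier R. a \<otimes>\<^bsub>R\<^esub> x = x \<and> x \<otimes>\<^bsub>R\<^esub> a = x}"
  let ?R = "corner_ring R a"
  have "a \<otimes> (a \<otimes> x \<otimes> a) = a \<otimes> x \<otimes> a" "a \<otimes> x \<otimes> a \<otimes> a = a \<otimes> x \<otimes> a" if "x \<in> carrier R" for x
    using that assms(2,3) m_assoc by (metis m_closed)+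
  hence C: "carrier ?R = ?C"
    using assms(2) by (auto simp: corner_ring_def) metis
  have L: "mult ?R = mult R" "add ?R = add R" "zero ?R = zero R" "one ?R = a"
    by (simp_all add: corner_ring_def)
  have mult: "x \<otimes> y \<in> ?C" if "x \<in> ?C" "y \<in> ?C" for x y
  proof -
    have "a \<otimes> (x \<otimes> y) = (a \<otimes> x) \<otimes> y" "x \<otimes> y \<otimes> a = x \<otimes> (y \<otimes> a)"
      using that assms(2) m_assoc[of a x y] m_assoc[of x y a] by auto
    thus ?thesis
      using that by simp
  qed
  have add: "x \<oplus> y \<in> ?C" "\<ominus> x \<in> ?C" if "x \<in> ?C" "y \<in> ?C" for x y
    using that assms(2) by (simp_all add: l_distr r_distr l_minus r_minus)
  show ?thesis
  proof (intro ringI abelian_groupI monoidI; unfold C L)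
    fix x assume x: "x \<in> ?C"
    show "\<exists>y\<in>?C. y \<oplus> x = \<zero>"
      by (rule bexI[of _ "\<ominus> x"], use x in \<open>simp add: l_neg\<close>, rule add[OF x x])
  next
    fix x y z assume "x \<in> ?C" "y \<in> ?C" "z \<in> ?C"
    hence xyz: "x \<in> carrier R" "y \<in> carrier R" "z \<in> carrier R" by simp_all
    show "x \<oplus> y \<oplus> z = x \<oplus> (y \<oplus> z)" "x \<otimes> y \<otimes> z = x \<otimes> (y \<otimes> z)"
      "(x \<oplus> y) \<otimes> z = x \<otimes> z \<oplus> y \<otimes> z" "z \<otimes> (x \<oplus> y) = z \<otimes> x \<oplus> z \<otimes> y"
      using xyz by (simp_all only: a_assoc m_assoc l_distr r_distr)
  next
    fix x y assume xy: "x \<in> ?C" "y \<in> ?C"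
    show "x \<oplus> y \<in> ?C" "x \<otimes> y \<in> ?C"
      using add mult xy by blast+
    show "x \<oplus> y = y \<oplus> x"
      using xy by (simp add: a_comm)
  qed (use assms(2,3) in simp_all)
qed

definition free_module :: "('a, 'm) ring_scheme \<Rightarrow> nat \<Rightarrow> (nat \<Rightarrow> 'a) set" where
  "free_module R n = {..<n} \<rightarrow>\<^sub>E carrier R"

definition right_module_iso ::
  "('a, 'm) ring_scheme \<Rightarrow> nat \<Rightarrow> nat \<Rightarrow> ((nat \<Rightarrow> 'a) \<Rightarrow> (nat \<Rightarrow> 'a)) \<Rightarrow> bool" where
  "right_module_iso R m n f \<longleftrightarrow>
     bij_betw f (free_module R m) (free_module R n) \<and>
     (\<forall>x\<in>free_module R m. \<forall>y\<in>free_module R m.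
        f (\<lambda>i\<in>{..<m}. x i \<oplus>\<^bsub>R\<^esub> y i) = (\<lambda>i\<in>{..<n}. f x i \<oplus>\<^bsub>R\<^esub> f y i)) \<and>
     (\<forall>x\<in>free_module R m. \<forall>r\<in>carrier R.
        f (\<lambda>i\<in>{..<m}. x i \<otimes>\<^bsub>R\<^esub> r) = (\<lambda>i\<in>{..<n}. f x i \<otimes>\<^bsub>R\<^esub> r))"

definition has_IBN :: "('a, 'm) ring_scheme \<Rightarrow> bool" where
  "has_IBN R \<longleftrightarrow>
     ring R \<and> (\<forall>m n. 0 < m \<and> 0 < n \<and> m \<noteq> n \<longrightarrow> (\<nexists>f. right_module_iso R m n f))"

end

theory Submission
  imports Defs "HOL-Library.Function_Algebras"
begin

text \<open>
  Let \<open>R = \<alpha>L\<alpha>\<close>. An isomorphism between \<open>R\<^sup>m\<close> and \<open>R\<^sup>n\<close> gives a pair of mutually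
  inverse matrices \<open>M\<close>, \<open>N\<close> over \<open>R\<close> (\<open>right_module_iso_matrices\<close>), and the task is to find an
  invariant of such matrices that remembers \<open>m\<close> and \<open>n\<close>. By hypothesis some linear functional on
  the span of the vertices kills every \<open>sX - \<Sum>t(e)\<close> with \<open>X \<in> \<Lambda>\<close> but not \<open>\<alpha>\<close>; clearing
  denominators makes it a function \<open>\<phi>\<close> from vertices to integers (\<open>integral_functional\<close>).

  If \<open>\<phi>\<close> were the dimension function of a finite-dimensional representation of \<open>L\<close>, dimensions would
  finish the proof. In general \<open>\<phi>\<close> takes both signs, and it is realised instead as the
  \<^emph>\<open>difference\<close> of two infinite-dimensional representations. Both are combinatorial: they come
  from branching systems, where the vertex \<open>v\<close> acts as the projection to the functions supported on
  a set of points \<open>D v\<close> and the edges and ghost edges act by injections between these sets. The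
  first system has \<open>D v = {0..}\<close>, the second has \<open>D' v = {\<phi> v..}\<close>, so that \<open>D v\<close> has \<open>\<phi> v\<close> points
  more than \<open>D' v\<close>. Because \<open>\<phi>\<close> respects the relations of the blocks in \<open>\<Lambda>\<close>, the injections of the
  two systems can be chosen to agree at all but finitely many points (\<open>branching_system_pair\<close>).
  Every element of \<open>L\<close>, hence also every matrix over \<open>L\<close>, then acts in the same way on all but
  finitely many basis vectors.

  The matrix \<open>M\<close> thus acts in two ways, once as an isomorphism between the spaces with bases \<open>m\<close>
  copies and \<open>n\<close> copies of the points of \<open>D\<close> over \<open>H\<close>, and once as an isomorphism between the same
  spaces for \<open>D'\<close>. When two isomorphisms agree on almost all basis vectors, the bases of their
  domains have the same relative size as the bases of their codomains
  (\<open>index_eq_of_commensurable_isos\<close>, an application of the exchange lemma), which here says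
  \<open>m \<cdot> \<phi>(\<alpha>) = n \<cdot> \<phi>(\<alpha>)\<close>. As \<open>\<phi>(\<alpha>) \<noteq> 0\<close>, this forces \<open>m = n\<close>. The argument counts dimensions and
  not traces, and so it yields an equality of integers even when the field has positive
  characteristic.
\<close>

section \<open>Counting in infinite-dimensional spaces\<close>

context vector_space
begin

lemma span_of_finite_subset:
  assumes "x \<in> span A"
  obtains B where "finite B" "B \<subseteq> A" "x \<in> span B"
proof -
  obtain B r where "finite B" "B \<subseteq> A" "x = (\<Sum>a\<in>B. scale (r a) a)"
    using assms unfolding span_explicit by blast
  moreover from this have "x \<in> span B"
    by (auto intro: span_sum span_scale span_base)
  ultimately show ?thesis
    using that by blast
qed

text \<open>The exchange lemma compares finite sets only. Expanding the members of \<open>F\<close> uses finitely many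
  elements of \<open>C\<close>, so \<open>C\<close> can be replaced by a finite subset \<open>D\<close>, whose size then cancels.\<close>
lemma card_le_of_span_over_common_part:
  assumes indep: "independent (C \<union> F)" and disj: "C \<inter> F = {}"
    and fin: "finite F" "finite F'" and span: "F \<subseteq> span (C \<union> F')"
  shows "card F \<le> card F'"
proof -
  have "\<forall>x\<in>F. \<exists>B. finite B \<and> B \<subseteq> C \<union> F' \<and> x \<in> span B"
    using span by (blast elim: span_of_finite_subset)
  from bchoice[OF this] obtain B where B: "\<And>x. x \<in> F \<Longrightarrow> finite (B x)"
      "\<And>x. x \<in> F \<Longrightarrow> B x \<subseteq> C \<union> F'" "\<And>x. x \<in> F \<Longrightarrow> x \<in> span (B x)"
    by blast
  define D where "D = (\<Union>x\<in>F. B x) \<inter> C"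
  have D: "finite D" "D \<subseteq> C" "D \<inter> F = {}"
    using fin(1) B(1) disj unfolding D_def by blast+
  have "F \<subseteq> span (D \<union> F')"
  proof
    fix x assume x: "x \<in> F"
    hence "B x \<subseteq> D \<union> F'"
      using B(2) unfolding D_def by blast
    thus "x \<in> span (D \<union> F')"
      using B(3)[OF x] span_mono by blast
  qed
  hence "D \<union> F \<subseteq> span (D \<union> F')"
    using span_superset[of "D \<union> F'"] by blast
  moreover have "independent (D \<union> F)"
    by (rule independent_mono[OF indep]) (use D in auto)
  ultimately have "card (D \<union> F) \<le> card (D \<union> F')"
    using independent_span_bound D fin by blast
  also have "\<dots> \<le> card D + card F'"
    by (rule card_Un_le)
  finally show ?thesis
    using D fin by (simp add: card_Un_disjoint)
qed

lemma independent_union_of_independent: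
  assumes "independent A" "independent B" "span A \<inter> span B \<subseteq> {0}"
  shows "independent (A \<union> B)"
  unfolding independent_explicit_finite_subsets
proof (intro allI impI ballI)
  fix S u v
  assume S: "S \<subseteq> A \<union> B" "finite S" and sum0: "(\<Sum>v\<in>S. scale (u v) v) = 0" and v: "v \<in> S"
  let ?f = "\<lambda>v. scale (u v) v"
  have sum: "sum ?f (S \<inter> A) + sum ?f (S - A) = 0"
    using sum.Int_Diff[OF S(2), of ?f A] sum0 by simp
  have mem: "sum ?f (S \<inter> A) \<in> span A" "sum ?f (S - A) \<in> span B"
    using S by (auto intro: span_sum span_scale span_base)
  have "sum ?f (S \<inter> A) = - sum ?f (S - A)"
    using sum by (simp only: eq_neg_iff_add_eq_0)
  hence "sum ?f (S \<inter> A) \<in> span B"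
    using span_neg[OF mem(2)] by simp
  hence zero: "sum ?f (S \<inter> A) = 0"
    using mem(1) assms(3) by blast
  hence "sum ?f (S - A) = 0"
    using sum by simp
  moreover note zero
  moreover have "S \<inter> A \<subseteq> A" "S - A \<subseteq> B" "finite (S \<inter> A)" "finite (S - A)"
    using S by auto
  ultimately have "\<forall>v\<in>S \<inter> A. u v = 0" "\<forall>v\<in>S - A. u v = 0"
    using assms(1,2) unfolding independent_explicit_finite_subsets by blast+
  thus "u v = 0"
    using v by blast
qed

end

definition fscale :: "'k::field \<Rightarrow> ('c \<Rightarrow> 'k) \<Rightarrow> 'c \<Rightarrow> 'k" where
  "fscale c x = (\<lambda>i. c * x i)"

interpretation fun_space: vector_space fscale
  by standard (auto simp: fscale_def algebra_simps)

definition delta :: "'c \<Rightarrow> 'c \<Rightarrow> 'k::field" where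
  "delta c = (\<lambda>i. if i = c then 1 else 0)"

text \<open>The vector space is the space of all functions, since pullbacks along partial maps are defined on
  it without any finiteness condition. Dimensions are counted in the subspaces spanned by the
  \<open>delta c\<close>.\<close>
definition fin_supported :: "'c set \<Rightarrow> ('c \<Rightarrow> 'k::field) set" where
  "fin_supported Y = {x. finite {c. x c \<noteq> 0} \<and> {c. x c \<noteq> 0} \<subseteq> Y}"

lemma delta_fin_supported: "c \<in> Y \<Longrightarrow> delta c \<in> fin_supported Y"
  by (auto simp: fin_supported_def delta_def)

lemma inj_delta: "inj (delta :: 'c \<Rightarrow> 'c \<Rightarrow> 'k::field)"
  by (rule injI) (metis delta_def zero_neq_one)

lemma sum_fun_apply: "(sum f A) c = (\<Sum>a\<in>A. f a c)" for f :: "'a \<Rightarrow> 'c \<Rightarrow> 'k::field"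
  by (induction A rule: infinite_finite_induct) simp_all

lemma span_delta: "fun_space.span (delta ` Y :: ('c \<Rightarrow> 'k::field) set) = fin_supported Y"
proof
  have "fun_space.subspace (fin_supported Y :: ('c \<Rightarrow> 'k) set)"
  proof (rule fun_space.subspaceI)
    fix x y :: "'c \<Rightarrow> 'k" assume xy: "x \<in> fin_supported Y" "y \<in> fin_supported Y"
    have sub: "{c. (x + y) c \<noteq> 0} \<subseteq> {c. x c \<noteq> 0} \<union> {c. y c \<noteq> 0}"
      by auto
    have "finite {c. (x + y) c \<noteq> 0}"
      by (rule finite_subset[OF sub]) (use xy in \<open>simp add: fin_supported_def\<close>)
    thus "x + y \<in> fin_supported Y"
      using xy sub unfolding fin_supported_def by blast
  next
    fix x :: "'c \<Rightarrow> 'k" and a assume x: "x \<in> fin_supported Y"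
    have sub: "{c. fscale a x c \<noteq> 0} \<subseteq> {c. x c \<noteq> 0}"
      by (auto simp: fscale_def)
    have "finite {c. fscale a x c \<noteq> 0}"
      by (rule finite_subset[OF sub]) (use x in \<open>simp add: fin_supported_def\<close>)
    thus "fscale a x \<in> fin_supported Y"
      using x sub unfolding fin_supported_def by blast
  qed (simp add: fin_supported_def)
  thus "fun_space.span (delta ` Y) \<subseteq> (fin_supported Y :: ('c \<Rightarrow> 'k) set)"
    by (intro fun_space.span_minimal) (auto simp: delta_fin_supported)
  show "fin_supported Y \<subseteq> (fun_space.span (delta ` Y) :: ('c \<Rightarrow> 'k) set)"
  proof
    fix x :: "'c \<Rightarrow> 'k" assume x: "x \<in> fin_supported Y"
    have "x = (\<Sum>c\<in>{c. x c \<noteq> 0}. fscale (x c) (delta c))"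
    proof
      fix b
      show "x b = (\<Sum>c\<in>{c. x c \<noteq> 0}. fscale (x c) (delta c)) b"
      proof -
        have fin: "finite {c. x c \<noteq> 0}"
          using x by (simp add: fin_supported_def)
        have "(\<Sum>c\<in>{c. x c \<noteq> 0}. fscale (x c) (delta c)) b
            = (\<Sum>c\<in>{c. x c \<noteq> 0}. if b = c then x c else 0)"
          unfolding sum_fun_apply by (rule sum.cong) (simp_all add: fscale_def delta_def)
        thus ?thesis
          using sum.delta'[OF fin, of b x] by simp
      qed
    qed
    also have "\<dots> \<in> fun_space.span (delta ` Y)"
      using x by (auto simp: fin_supported_def intro!: fun_space.span_sum fun_space.span_scale
          intro: fun_space.span_base)
    finally show "x \<in> fun_space.span (delta ` Y)" .
  qed
qed

lemma independent_delta: "fun_space.independent (delta ` Y :: ('c \<Rightarrow> 'k::field) set)"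
  unfolding fun_space.dependent_def
proof
  assume "\<exists>a\<in>delta ` Y :: ('c \<Rightarrow> 'k) set. a \<in> fun_space.span (delta ` Y - {a})"
  then obtain c where "(delta c :: 'c \<Rightarrow> 'k) \<in> fun_space.span (delta ` Y - {delta c})"
    by auto
  also have "delta ` Y - {delta c :: 'c \<Rightarrow> 'k} = delta ` (Y - {c})"
    by (simp add: image_set_diff[OF inj_delta])
  finally have "(delta c :: 'c \<Rightarrow> 'k) \<in> fin_supported (Y - {c})"
    by (simp add: span_delta)
  moreover have "(delta c c :: 'k) \<noteq> 0"
    by (simp add: delta_def)
  ultimately show False
    by (auto simp: fin_supported_def subset_iff)
qed

text \<open>The images under \<open>S\<close> of the basis vectors over \<open>P\<close>, together with the basis vectors over
  \<open>Q' - Q\<close>, are independent; the images under \<open>T\<close> of those over \<open>P'\<close>, together with the basis vectors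
  over \<open>Q - Q'\<close>, span everything over \<open>Q \<union> Q'\<close>. Both families contain the images of \<open>C\<close>, and the
  finite remainders are compared.\<close>
lemma card_le_of_commensurable_maps:
  fixes S T :: "('p \<Rightarrow> 'k::field) \<Rightarrow> ('q \<Rightarrow> 'k)"
  assumes lin: "Vector_Spaces.linear fscale fscale S" "Vector_Spaces.linear fscale fscale T"
    and inj: "inj_on S (fin_supported P)" and into: "S ` fin_supported P \<subseteq> fin_supported Q"
    and surj: "fin_supported Q' \<subseteq> T ` fin_supported P'"
    and C: "C \<subseteq> P \<inter> P'" "\<And>c. c \<in> C \<Longrightarrow> S (delta c) = T (delta c)"
    and fin: "finite (P - C)" "finite (P' - C)" "finite (Q - Q')" "finite (Q' - Q)"
  shows "card (P - C) + card (Q' - Q) \<le> card (P' - C) + card (Q - Q')"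
proof -
  interpret S: Vector_Spaces.linear fscale fscale S by (rule lin)
  interpret T: Vector_Spaces.linear fscale fscale T by (rule lin)
  let ?d = "delta :: 'q \<Rightarrow> 'q \<Rightarrow> 'k"
  let ?Sd = "\<lambda>p. S (delta p)" and ?Td = "\<lambda>p. T (delta p)"
  define F where "F = ?Sd ` (P - C) \<union> ?d ` (Q' - Q)"
  define F' where "F' = ?Td ` (P' - C) \<union> ?d ` (Q - Q')"
  have inj_Sd: "inj_on ?Sd P"
  proof (rule inj_onI)
    fix p q assume pq: "p \<in> P" "q \<in> P" "?Sd p = ?Sd q"
    have "(delta p :: 'p \<Rightarrow> 'k) = delta q"
      by (rule inj_onD[OF inj pq(3) delta_fin_supported[OF pq(1)] delta_fin_supported[OF pq(2)]])
    thus "p = q"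
      by (rule injD[OF inj_delta])
  qed
  have span_SP: "fun_space.span (?Sd ` P) \<subseteq> fin_supported Q"
    using into S.span_image[of "delta ` P"] by (simp add: image_image span_delta)
  have zero: "fin_supported Q \<inter> fin_supported (Q' - Q) = {0 :: 'q \<Rightarrow> 'k}"
    by (fastforce simp: fin_supported_def)
  have d_notin: "?d q \<notin> fin_supported Q" if "q \<in> Q' - Q" for q
    using that by (auto simp: fin_supported_def delta_def)
  have disj: "?Sd ` P \<inter> ?d ` (Q' - Q) = {}"
  proof (rule equals0I, elim IntE)
    fix x assume "x \<in> ?Sd ` P" and d: "x \<in> ?d ` (Q' - Q)"
    hence "x \<in> fin_supported Q"
      using span_SP fun_space.span_base by (metis subsetD)
    thus False
      using d_notin imageE[OF d] by metis
  qed
  have "fun_space.independent (?Sd ` P)"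
    using S.independent_injective_image[OF independent_delta, of P] inj
    by (simp add: span_delta image_image)
  hence "fun_space.independent (?Sd ` P \<union> ?d ` (Q' - Q))"
    using span_SP zero by (intro fun_space.independent_union_of_independent independent_delta)
      (auto simp: span_delta)
  also have "?Sd ` P \<union> ?d ` (Q' - Q) = ?Sd ` C \<union> F"
    using C(1) by (auto simp: F_def)
  finally have indep: "fun_space.independent (?Sd ` C \<union> F)" .
  have disj': "?Sd ` C \<inter> F = {}"
  proof -
    have "?Sd ` C \<inter> ?Sd ` (P - C) = {}"
      using inj_on_image_Int[OF inj_Sd, of C "P - C"] C(1) by auto
    moreover have "?Sd ` C \<inter> ?d ` (Q' - Q) = {}"
      using disj C(1) by blast
    ultimately show ?thesis
      unfolding F_def by blast
  qed
  have "F \<subseteq> fun_space.span (?Sd ` C \<union> F')"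
  proof -
    have "fin_supported Q' \<subseteq> fun_space.span (?Td ` P')"
      using surj T.span_image[of "delta ` P'"] by (simp add: image_image span_delta)
    also have "?Td ` P' \<subseteq> ?Sd ` C \<union> F'"
      using C(2) by (auto simp: F'_def)
    hence "fun_space.span (?Td ` P') \<subseteq> fun_space.span (?Sd ` C \<union> F')"
      by (rule fun_space.span_mono)
    finally have Q': "fin_supported Q' \<subseteq> fun_space.span (?Sd ` C \<union> F')" .
    have d: "?d q \<in> fun_space.span (?Sd ` C \<union> F')" if "q \<in> Q \<union> Q'" for q
    proof (cases "q \<in> Q'")
      case True
      thus ?thesis
        by (intro subsetD[OF Q'] delta_fin_supported)
    next
      case False
      with that have "?d q \<in> F'"
        by (simp add: F'_def)
      thus ?thesis
        by (simp add: fun_space.span_base)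
    qed
    hence "fin_supported (Q \<union> Q') \<subseteq> fun_space.span (?Sd ` C \<union> F')"
      unfolding span_delta[symmetric]
      by (intro fun_space.span_minimal fun_space.subspace_span image_subsetI)
    moreover have "?Sd p \<in> fin_supported (Q \<union> Q')" if "p \<in> P" for p
    proof -
      have "?Sd p \<in> fin_supported Q"
        by (rule subsetD[OF into imageI[OF delta_fin_supported[OF that]]])
      thus ?thesis
        by (auto simp: fin_supported_def)
    qed
    ultimately have "?Sd p \<in> fun_space.span (?Sd ` C \<union> F')" if "p \<in> P" for p
      using that by (metis subsetD)
    thus ?thesis
      unfolding F_def by (intro Un_least image_subsetI d) auto
  qed
  hence "card F \<le> card F'"
    by (intro fun_space.card_le_of_span_over_common_part[OF indep disj'])
      (use fin in \<open>simp_all add: F_def F'_def\<close>)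
  moreover have "card F = card (P - C) + card (Q' - Q)"
  proof -
    have "card F = card (?Sd ` (P - C)) + card (?d ` (Q' - Q))"
      unfolding F_def by (rule card_Un_disjoint) (use fin disj in auto)
    thus ?thesis
      using inj_on_subset[OF inj_Sd, of "P - C"]
      by (simp add: card_image card_image[OF inj_on_subset[OF inj_delta subset_UNIV]])
  qed
  moreover have "card F' \<le> card (P' - C) + card (Q - Q')"
    unfolding F'_def
    by (rule order_trans[OF card_Un_le]) (intro add_mono card_image_le fin)
  ultimately show ?thesis
    by simp
qed

text \<open>This is the invariance of the Fredholm index under finite-rank perturbations. Restricted to the
  span of the basis vectors on which they agree, and with values in the functions over \<open>Q \<union> Q'\<close>,
  \<open>S\<close> and \<open>T\<close> are the same injective map; the codimension of its image, computed once with \<open>S\<close> and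
  once with \<open>T\<close>, gives the equation.\<close>
lemma index_eq_of_commensurable_isos:
  fixes S T :: "('p \<Rightarrow> 'k::field) \<Rightarrow> ('q \<Rightarrow> 'k)"
  assumes lin: "Vector_Spaces.linear fscale fscale S" "Vector_Spaces.linear fscale fscale T"
    and bij: "bij_betw S (fin_supported P) (fin_supported Q)" "bij_betw T (fin_supported P') (fin_supported Q')"
    and agree: "finite {p. S (delta p) \<noteq> T (delta p)}"
    and fin: "finite (P - P')" "finite (P' - P)" "finite (Q - Q')" "finite (Q' - Q)"
  shows "card (P - P') + card (Q' - Q) = card (P' - P) + card (Q - Q')"
proof -
  define C where "C = {p \<in> P \<inter> P'. S (delta p) = T (delta p)}"
  have fin_common: "finite (P \<inter> P' - C)"
    by (rule finite_subset[OF _ agree]) (auto simp: C_def)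
  have split: "P - C = (P - P') \<union> (P \<inter> P' - C)" "P' - C = (P' - P) \<union> (P \<inter> P' - C)"
    by (auto simp: C_def)
  have finC: "finite (P - C)" "finite (P' - C)"
    unfolding split using fin fin_common by simp_all
  have card: "card (P - C) = card (P - P') + card (P \<inter> P' - C)"
    "card (P' - C) = card (P' - P) + card (P \<inter> P' - C)"
    unfolding split by (rule card_Un_disjoint; use fin fin_common in auto)+
  have "card (P - C) + card (Q' - Q) \<le> card (P' - C) + card (Q - Q')"
    using bij by (intro card_le_of_commensurable_maps[OF lin] finC fin)
      (auto simp: bij_betw_def C_def)
  moreover have "card (P' - C) + card (Q - Q') \<le> card (P - C) + card (Q' - Q)"
    using bij by (intro card_le_of_commensurable_maps[OF lin(2,1)] finC fin)
      (auto simp: bij_betw_def C_def)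
  ultimately show ?thesis
    using card by linarith
qed

section \<open>Noncommutative polynomials acting through partial maps\<close>

text \<open>A generator acts on functions by pulling back along a partial map, with value zero where the map is
  undefined. Pulling back reverses composition, so the leftmost letter of a word moves the point
  first; with this order \<open>act\<close> is a left action.\<close>
primrec pull :: "('g \<Rightarrow> 'b \<Rightarrow> 'b option) \<Rightarrow> 'g list \<Rightarrow> 'b \<Rightarrow> 'b option" where
  "pull \<pi> [] b = Some b"
| "pull \<pi> (g # gs) b = Option.bind (\<pi> g b) (pull \<pi> gs)"

definition value_at :: "('b \<Rightarrow> 'k::zero) \<Rightarrow> 'b option \<Rightarrow> 'k" where
  "value_at x z = (case z of None \<Rightarrow> 0 | Some b \<Rightarrow> x b)"

definition act ::
  "('g \<Rightarrow> 'b \<Rightarrow> 'b option) \<Rightarrow> ('g, 'k::field) ncpoly \<Rightarrow> ('b \<Rightarrow> 'k) \<Rightarrow> 'b \<Rightarrow> 'k" where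
  "act \<pi> p x b =
     (\<Sum>w\<in>Poly_Mapping.keys p. Poly_Mapping.lookup p w * value_at x (pull \<pi> (letters w) b))"

lemma value_at_simps [simp]: "value_at x None = 0" "value_at x (Some b) = x b"
  by (simp_all add: value_at_def)

lemma pull_append: "pull \<pi> (gs @ hs) b = Option.bind (pull \<pi> gs b) (pull \<pi> hs)"
proof (induction gs arbitrary: b)
  case (Cons g gs)
  thus ?case
    by (cases "\<pi> g b") simp_all
qed simp

lemma act_superset:
  assumes "finite S" "Poly_Mapping.keys p \<subseteq> S"
  shows "act \<pi> p x b = (\<Sum>w\<in>S. Poly_Mapping.lookup p w * value_at x (pull \<pi> (letters w) b))"
  unfolding act_def using assms by (intro sum.mono_neutral_left) (auto simp: in_keys_iff)

lemma act_0 [simp]: "act \<pi> 0 x b = 0"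
  by (simp add: act_def)

lemma act_single [simp]:
  "act \<pi> (Poly_Mapping.single w c) x b = c * value_at x (pull \<pi> (letters w) b)"
  by (subst act_superset[of "{w}"]) simp_all

lemma act_add: "act \<pi> (p + q) x b = act \<pi> p x b + act \<pi> q x b"
proof -
  let ?S = "Poly_Mapping.keys p \<union> Poly_Mapping.keys q"
  have S: "finite ?S" "Poly_Mapping.keys p \<subseteq> ?S" "Poly_Mapping.keys q \<subseteq> ?S" "Poly_Mapping.keys (p + q) \<subseteq> ?S"
    using Poly_Mapping.keys_add[of p q] by auto
  show ?thesis
    by (simp add: act_superset[OF S(1,2)] act_superset[OF S(1,3)] act_superset[OF S(1,4)]
        lookup_add distrib_right sum.distrib)
qed

lemma act_uminus: "act \<pi> (- p) x b = - act \<pi> p x b"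
  by (simp add: act_def sum_negf)

lemma act_diff: "act \<pi> (p - q) x b = act \<pi> p x b - act \<pi> q x b"
  using act_add[of \<pi> p "- q" x b] by (simp add: act_uminus)

lemma act_sum: "act \<pi> (sum h J) x b = (\<Sum>j\<in>J. act \<pi> (h j) x b)"
  by (induction J rule: infinite_finite_induct) (simp_all add: act_add)

lemma act_gen [simp]: "act \<pi> (gen g) x b = value_at x (\<pi> g b)"
  by (cases "\<pi> g b") (simp_all add: gen_def)

lemma sum_of_terms:
  "p = (\<Sum>w\<in>Poly_Mapping.keys p. Poly_Mapping.single w (Poly_Mapping.lookup p w))"
  by (rule poly_mapping_eqI) (auto simp: lookup_sum lookup_single when_def in_keys_iff)

lemma act_single_mult:
  "act \<pi> (Poly_Mapping.single u c * q) x b = act \<pi> (Poly_Mapping.single u c) (act \<pi> q x) b"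
proof -
  let ?s = "\<lambda>w. Poly_Mapping.single w (Poly_Mapping.lookup q w)"
  have "Poly_Mapping.single u c * q = (\<Sum>w\<in>Poly_Mapping.keys q. Poly_Mapping.single u c * ?s w)"
    by (subst sum_of_terms[of q]) (simp add: sum_distrib_left)
  hence "act \<pi> (Poly_Mapping.single u c * q) x b = (\<Sum>w\<in>Poly_Mapping.keys q.
      c * Poly_Mapping.lookup q w * value_at x (Option.bind (pull \<pi> (letters u) b) (pull \<pi> (letters w))))"
    by (simp add: act_sum mult_single plus_word_def pull_append)
  also have "\<dots> = c * value_at (act \<pi> q x) (pull \<pi> (letters u) b)"
    by (cases "pull \<pi> (letters u) b") (simp_all add: act_def sum_distrib_left mult.assoc)
  finally show ?thesis
    by simp
qed

lemma act_mult: "act \<pi> (p * q) x b = act \<pi> p (act \<pi> q x) b"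
proof -
  let ?s = "\<lambda>w. Poly_Mapping.single w (Poly_Mapping.lookup p w)"
  have "act \<pi> (p * q) x b = act \<pi> (\<Sum>w\<in>Poly_Mapping.keys p. ?s w * q) x b"
    by (subst sum_of_terms[of p]) (simp add: sum_distrib_right)
  also have "\<dots> = act \<pi> (\<Sum>w\<in>Poly_Mapping.keys p. ?s w) (act \<pi> q x) b"
    by (simp only: act_sum act_single_mult)
  finally show ?thesis
    by (simp flip: sum_of_terms)
qed

lemma act_zero [simp]: "act \<pi> p (\<lambda>b. 0) b = 0"
  by (simp add: act_def value_at_def option.case_eq_if)

lemma act_add_right: "act \<pi> p (\<lambda>b. x b + y b) c = act \<pi> p x c + act \<pi> p y c"
proof -
  have "value_at (\<lambda>b. x b + y b) z = value_at x z + value_at y z" for z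
    by (cases z) simp_all
  thus ?thesis
    by (simp add: act_def sum.distrib distrib_left)
qed

lemma act_scale_right: "act \<pi> p (\<lambda>b. r * x b) c = r * act \<pi> p x c"
proof -
  have "value_at (\<lambda>b. r * x b) z = r * value_at x z" for z
    by (cases z) simp_all
  thus ?thesis
    by (simp add: act_def sum_distrib_left mult.left_commute)
qed

lemma act_sum_right: "act \<pi> p (\<lambda>b. \<Sum>j\<in>J. x j b) c = (\<Sum>j\<in>J. act \<pi> p (x j) c)"
  by (induction J rule: infinite_finite_induct) (simp_all add: act_add_right)

text \<open>Precisely this condition makes the pullback preserve finite supports. It also keeps disagreements
  finite: where the first letter agrees, a word can only disagree at a point that is moved into the
  disagreement set of the remaining letters, and there are finitely many such points.\<close>
definition finite_to_one :: "('b \<Rightarrow> 'b option) \<Rightarrow> bool" where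
  "finite_to_one f \<longleftrightarrow> (\<forall>c. finite {b. f b = Some c})"

lemma finite_to_one_pull:
  assumes "\<And>g. finite_to_one (\<pi> g)"
  shows "finite_to_one (pull \<pi> gs)"
proof (induction gs)
  case (Cons g gs)
  have "{b. pull \<pi> (g # gs) b = Some c} = (\<Union>a\<in>{a. pull \<pi> gs a = Some c}. {b. \<pi> g b = Some a})" for c
    by (auto simp: bind_eq_Some_conv)
  thus ?case
    using assms Cons by (simp add: finite_to_one_def)
qed (simp add: finite_to_one_def)

lemma finite_support_act:
  assumes "\<And>g. finite_to_one (\<pi> g)" "finite {b. x b \<noteq> 0}"
  shows "finite {b. act \<pi> p x b \<noteq> 0}"
proof (rule finite_subset)
  show "finite (\<Union>w\<in>Poly_Mapping.keys p. \<Union>c\<in>{c. x c \<noteq> 0}. {b. pull \<pi> (letters w) b = Some c})"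
    using assms(2) finite_to_one_pull[of \<pi>, OF assms(1)] by (simp add: finite_to_one_def)
  show "{b. act \<pi> p x b \<noteq> 0}
      \<subseteq> (\<Union>w\<in>Poly_Mapping.keys p. \<Union>c\<in>{c. x c \<noteq> 0}. {b. pull \<pi> (letters w) b = Some c})"
  proof
    fix b assume "b \<in> {b. act \<pi> p x b \<noteq> 0}"
    hence "\<exists>w\<in>Poly_Mapping.keys p. value_at x (pull \<pi> (letters w) b) \<noteq> 0"
      unfolding act_def mem_Collect_eq by (metis (mono_tags, lifting) mult_zero_right sum.neutral)
    then obtain w where w: "w \<in> Poly_Mapping.keys p" "value_at x (pull \<pi> (letters w) b) \<noteq> 0"
      by blast
    thus "b \<in> (\<Union>w\<in>Poly_Mapping.keys p. \<Union>c\<in>{c. x c \<noteq> 0}. {b. pull \<pi> (letters w) b = Some c})"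
      by (cases "pull \<pi> (letters w) b") auto
  qed
qed

lemma finite_disagreement_pull:
  assumes "\<And>g. finite_to_one (\<pi> g)" "\<And>g. finite {b. \<pi> g b \<noteq> \<rho> g b}"
  shows "finite {b. pull \<pi> gs b \<noteq> pull \<rho> gs b}"
proof (induction gs)
  case (Cons g gs)
  show ?case
  proof (rule finite_subset)
    show "{b. pull \<pi> (g # gs) b \<noteq> pull \<rho> (g # gs) b}
        \<subseteq> {b. \<pi> g b \<noteq> \<rho> g b} \<union> (\<Union>a\<in>{a. pull \<pi> gs a \<noteq> pull \<rho> gs a}. {b. \<pi> g b = Some a})"
    proof
      fix b assume b: "b \<in> {b. pull \<pi> (g # gs) b \<noteq> pull \<rho> (g # gs) b}"
      show "b \<in> {b. \<pi> g b \<noteq> \<rho> g b} \<union> (\<Union>a\<in>{a. pull \<pi> gs a \<noteq> pull \<rho> gs a}. {b. \<pi> g b = Some a})"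
        using b by (cases "\<pi> g b"; cases "\<rho> g b") auto
    qed
    show "finite ({b. \<pi> g b \<noteq> \<rho> g b} \<union> (\<Union>a\<in>{a. pull \<pi> gs a \<noteq> pull \<rho> gs a}. {b. \<pi> g b = Some a}))"
      using assms Cons by (simp add: finite_to_one_def)
  qed
qed simp

lemma finite_disagreement_act:
  fixes p :: "('g, 'k::field) ncpoly"
  assumes "\<And>g. finite_to_one (\<pi> g)" "\<And>g. finite_to_one (\<rho> g)" "\<And>g. finite {b. \<pi> g b \<noteq> \<rho> g b}"
  shows "finite {c. act \<pi> p (delta c) \<noteq> act \<rho> p (delta c)}"
proof (rule finite_subset)
  let ?B = "\<lambda>w. {b. pull \<pi> (letters w) b \<noteq> pull \<rho> (letters w) b}"
  let ?D = "\<lambda>w. {c. \<exists>b\<in>?B w. pull \<pi> (letters w) b = Some c \<or> pull \<rho> (letters w) b = Some c}"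
  have "finite (?D w)" for w :: "'g word"
  proof -
    have "?D w \<subseteq> (\<lambda>b. the (pull \<pi> (letters w) b)) ` ?B w \<union> (\<lambda>b. the (pull \<rho> (letters w) b)) ` ?B w"
      by force
    thus ?thesis
      by (rule finite_subset) (intro finite_UnI finite_imageI finite_disagreement_pull assms)
  qed
  thus "finite (\<Union>w\<in>Poly_Mapping.keys p. ?D w)"
    by simp
  show "{c. act \<pi> p (delta c) \<noteq> act \<rho> p (delta c)} \<subseteq> (\<Union>w\<in>Poly_Mapping.keys p. ?D w)"
  proof (rule ccontr)
    assume "\<not> ?thesis"
    then obtain c where c: "act \<pi> p (delta c) \<noteq> act \<rho> p (delta c)"
      and nc: "\<And>w. w \<in> Poly_Mapping.keys p \<Longrightarrow> c \<notin> ?D w"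
      by blast
    have "value_at (delta c) (pull \<pi> (letters w) b) = (value_at (delta c) (pull \<rho> (letters w) b) :: 'k)"
      if "w \<in> Poly_Mapping.keys p" for w b
    proof -
      have "pull \<pi> (letters w) b = pull \<rho> (letters w) b
          \<or> pull \<pi> (letters w) b \<noteq> Some c \<and> pull \<rho> (letters w) b \<noteq> Some c"
        using nc[OF that] by blast
      thus ?thesis
        by (cases "pull \<pi> (letters w) b"; cases "pull \<rho> (letters w) b") (auto simp: delta_def)
    qed
    hence "act \<pi> p (delta c) = act \<rho> p (delta c)"
      by (auto simp: act_def intro!: sum.cong)
    with c show False ..
  qed
qed

section \<open>Matrices of noncommutative polynomials\<close>

definition mat_act ::
  "('g \<Rightarrow> 'b \<Rightarrow> 'b option) \<Rightarrow> nat \<Rightarrow> nat \<Rightarrow> (nat \<Rightarrow> nat \<Rightarrow> ('g, 'k::field) ncpoly) \<Rightarrow>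
   (nat \<times> 'b \<Rightarrow> 'k) \<Rightarrow> nat \<times> 'b \<Rightarrow> 'k" where
  "mat_act \<pi> n m M x = (\<lambda>(i, b).
     if i < n then \<Sum>j<m. act \<pi> (M i j) (\<lambda>b. x (j, b)) b else 0)"

lemma linear_mat_act: "Vector_Spaces.linear fscale fscale (mat_act \<pi> n m M)"
  by unfold_locales (auto simp: fun_eq_iff mat_act_def fscale_def act_add_right act_scale_right
      sum.distrib sum_distrib_left)

lemma mat_act_mult:
  fixes M N :: "nat \<Rightarrow> nat \<Rightarrow> ('g, 'k::field) ncpoly" and x :: "nat \<times> 'b \<Rightarrow> 'k"
  shows "mat_act \<pi> n m M (mat_act \<pi> m l N x) = mat_act \<pi> n l (\<lambda>i k. \<Sum>j<m. M i j * N j k) x"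
proof
  fix ib :: "nat \<times> 'b"
  obtain i b where ib: "ib = (i, b)"
    by fastforce
  have "(\<Sum>j<m. act \<pi> (M i j) (\<lambda>b. mat_act \<pi> m l N x (j, b)) b)
      = (\<Sum>j<m. \<Sum>k<l. act \<pi> (M i j * N j k) (\<lambda>b. x (k, b)) b)"
    by (intro sum.cong refl) (simp add: mat_act_def act_sum_right act_mult)
  also have "\<dots> = (\<Sum>k<l. act \<pi> (\<Sum>j<m. M i j * N j k) (\<lambda>b. x (k, b)) b)"
    by (subst sum.swap) (simp add: act_sum)
  finally show "mat_act \<pi> n m M (mat_act \<pi> m l N x) ib
      = mat_act \<pi> n l (\<lambda>i k. \<Sum>j<m. M i j * N j k) x ib"
    by (simp add: ib mat_act_def)
qed

lemma finite_support_mat_act: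
  assumes "\<And>g. finite_to_one (\<pi> g)" "finite {c. x c \<noteq> 0}"
  shows "finite {c. mat_act \<pi> n m M x c \<noteq> 0}"
proof (rule finite_subset)
  have x: "finite {b. x (j, b) \<noteq> 0}" for j
    using finite_vimageI[OF assms(2), of "Pair j"] by (simp add: inj_def vimage_def)
  show "{c. mat_act \<pi> n m M x c \<noteq> 0}
      \<subseteq> (\<Union>i<n. \<Union>j<m. Pair i ` {b. act \<pi> (M i j) (\<lambda>b. x (j, b)) b \<noteq> 0})"
  proof
    fix c assume c: "c \<in> {c. mat_act \<pi> n m M x c \<noteq> 0}"
    obtain i b where ib: "c = (i, b)"
      by fastforce
    have i: "i < n" and "(\<Sum>j<m. act \<pi> (M i j) (\<lambda>b. x (j, b)) b) \<noteq> 0"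
      using c by (auto simp: ib mat_act_def split: if_splits)
    then obtain j where "j < m" "act \<pi> (M i j) (\<lambda>b. x (j, b)) b \<noteq> 0"
      by (metis (mono_tags, lifting) lessThan_iff sum.neutral)
    thus "c \<in> (\<Union>i<n. \<Union>j<m. Pair i ` {b. act \<pi> (M i j) (\<lambda>b. x (j, b)) b \<noteq> 0})"
      using i by (auto simp: ib)
  qed
  show "finite (\<Union>i<n. \<Union>j<m. Pair i ` {b. act \<pi> (M i j) (\<lambda>b. x (j, b)) b \<noteq> 0})"
    using finite_support_act[of \<pi>, OF assms(1) x] by simp
qed

lemma mat_act_delta:
  fixes M :: "nat \<Rightarrow> nat \<Rightarrow> ('g, 'k::field) ncpoly"
  shows "mat_act \<pi> n m M (delta (j, c)) =
     (\<lambda>(i, b). if i < n \<and> j < m then act \<pi> (M i j) (delta c) b else 0)"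
proof -
  have "(\<lambda>b. delta (j, c) (k, b) :: 'k) = (if k = j then delta c else (\<lambda>b. 0))" for k
    by (auto simp: delta_def fun_eq_iff)
  hence "(\<Sum>k<m. act \<pi> (M i k) (\<lambda>b. delta (j, c) (k, b)) b)
      = (\<Sum>k<m. if k = j then act \<pi> (M i k) (delta c) b else 0)" for i b
    by (intro sum.cong) auto
  thus ?thesis
    by (auto simp: mat_act_def fun_eq_iff)
qed

lemma finite_disagreement_mat_act:
  fixes M :: "nat \<Rightarrow> nat \<Rightarrow> ('g, 'k::field) ncpoly"
  assumes "\<And>g. finite_to_one (\<pi> g)" "\<And>g. finite_to_one (\<rho> g)" "\<And>g. finite {b. \<pi> g b \<noteq> \<rho> g b}"
  shows "finite {c. mat_act \<pi> n m M (delta c) \<noteq> mat_act \<rho> n m M (delta c)}"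
proof (rule finite_subset)
  show "{c. mat_act \<pi> n m M (delta c) \<noteq> mat_act \<rho> n m M (delta c)}
      \<subseteq> (\<Union>i<n. \<Union>j<m. Pair j ` {c. act \<pi> (M i j) (delta c) \<noteq> act \<rho> (M i j) (delta c)})"
  proof
    fix jc assume jc: "jc \<in> {c. mat_act \<pi> n m M (delta c) \<noteq> mat_act \<rho> n m M (delta c)}"
    obtain j c where "jc = (j, c)"
      by fastforce
    with jc obtain i where "i < n" "j < m" "act \<pi> (M i j) (delta c) \<noteq> act \<rho> (M i j) (delta c)"
      by (auto simp: mat_act_delta fun_eq_iff split: if_splits)
    thus "jc \<in> (\<Union>i<n. \<Union>j<m. Pair j ` {c. act \<pi> (M i j) (delta c) \<noteq> act \<rho> (M i j) (delta c)})"
      using \<open>jc = (j, c)\<close> by auto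
  qed
  show "finite (\<Union>i<n. \<Union>j<m. Pair j ` {c. act \<pi> (M i j) (delta c) \<noteq> act \<rho> (M i j) (delta c)})"
    by (intro finite_UN_I finite_lessThan finite_imageI finite_disagreement_act assms)
qed

section \<open>Branching systems\<close>

text \<open>An edge should send the basis vector at \<open>(head G e, i)\<close> to the one at \<open>(tail G e, \<theta> e i)\<close>. As
  functions are pulled back, the partial map of an edge is the inverse of this injection, and that of
  a ghost edge is the injection itself.\<close>
fun branch_map ::
  "('v, 'e) pre_digraph \<Rightarrow> ('v \<Rightarrow> 'b set) \<Rightarrow> ('e \<Rightarrow> 'b \<Rightarrow> 'b) \<Rightarrow> ('v, 'e) cl_gen \<Rightarrow>
   'v \<times> 'b \<Rightarrow> ('v \<times> 'b) option" where
  "branch_map G D \<theta> (Vert w) (v, i) = (if v = w \<and> i \<in> D v then Some (v, i) else None)"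
| "branch_map G D \<theta> (Edge e) (v, j) =
     (if e \<in> arcs G \<and> v = tail G e \<and> j \<in> \<theta> e ` D (head G e)
      then Some (head G e, inv_into (D (head G e)) (\<theta> e) j) else None)"
| "branch_map G D \<theta> (Ghost e) (v, i) =
     (if e \<in> arcs G \<and> v = head G e \<and> i \<in> D v then Some (tail G e, \<theta> e i) else None)"

text \<open>The relations of the algebra say that the edges in a block embed the disjoint union of the spaces at
  their targets into the space at their source, and that this embedding is onto for blocks in \<open>\<Lambda>\<close>.
  A branching system is such a family of embeddings on the level of bases.\<close>
locale branching_system =
  fixes G :: "('v, 'e) pre_digraph" and \<P> \<Lambda> :: "'e set set"
    and D :: "'v \<Rightarrow> 'b set" and \<theta> :: "'e \<Rightarrow> 'b \<Rightarrow> 'b"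
  assumes fin_G: "fin_digraph G" and sep: "separated_graph G \<P>" and sub: "\<Lambda> \<subseteq> \<P>"
    and into: "e \<in> arcs G \<Longrightarrow> i \<in> D (head G e) \<Longrightarrow> \<theta> e i \<in> D (tail G e)"
    and inj: "X \<in> \<P> \<Longrightarrow> e \<in> X \<Longrightarrow> f \<in> X \<Longrightarrow> i \<in> D (head G e) \<Longrightarrow> j \<in> D (head G f) \<Longrightarrow>
      \<theta> e i = \<theta> f j \<Longrightarrow> e = f \<and> i = j"
    and onto: "X \<in> \<Lambda> \<Longrightarrow> j \<in> D (block_source G X) \<Longrightarrow> \<exists>e\<in>X. j \<in> \<theta> e ` D (head G e)"
begin

abbreviation \<pi> where "\<pi> \<equiv> branch_map G D \<theta>"

lemma inj_on_branch:
  assumes "e \<in> arcs G"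
  shows "inj_on (\<theta> e) (D (head G e))"
proof -
  have "e \<in> \<Union>\<P>"
    using sep assms by (simp add: separated_graph_def refines_def partition_on_def)
  then obtain X where "X \<in> \<P>" "e \<in> X"
    by blast
  thus ?thesis
    using inj by (auto simp: inj_on_def)
qed

lemma finite_to_one_branch_map: "finite_to_one (\<pi> g)"
  unfolding finite_to_one_def
proof
  fix c
  show "finite {b. \<pi> g b = Some c}"
  proof (cases g)
    case (Vert w)
    have "{b. \<pi> g b = Some c} \<subseteq> {c}"
      by (auto simp: Vert split: if_splits)
    thus ?thesis
      using finite_subset by blast
  next
    case (Edge e)
    have "{b. \<pi> g b = Some c} \<subseteq> {(tail G e, \<theta> e (snd c))}"
      by (auto simp: Edge f_inv_into_f split: if_splits)
    thus ?thesis
      using finite_subset by blast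
  next
    case (Ghost e)
    have "{b. \<pi> g b = Some c} \<subseteq> {(head G e, inv_into (D (head G e)) (\<theta> e) (snd c))}"
      by (auto simp: Ghost inv_into_f_f[OF inj_on_branch] split: if_splits)
    thus ?thesis
      using finite_subset by blast
  qed
qed

lemma act_cl_relator:
  fixes r :: "(('v, 'e) cl_gen, 'k::field) ncpoly"
  assumes "r \<in> cl_relators G \<P> \<Lambda>"
  shows "act \<pi> r x b = 0"
proof -
  obtain v i where b: "b = (v, i)"
    by fastforce
  note act_simps = act_diff act_mult b
  from assms consider
      (V) u w where "r = gen (Vert u) * gen (Vert w) - (if u = w then gen (Vert u) else 0)"
    | (E1) e where "e \<in> arcs G" "r = gen (Vert (tail G e)) * gen (Edge e) - gen (Edge e)"
    | (E1') e where "e \<in> arcs G" "r = gen (Edge e) * gen (Vert (head G e)) - gen (Edge e)"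
    | (E2) e where "e \<in> arcs G" "r = gen (Vert (head G e)) * gen (Ghost e) - gen (Ghost e)"
    | (E2') e where "e \<in> arcs G" "r = gen (Ghost e) * gen (Vert (tail G e)) - gen (Ghost e)"
    | (CK1) e f X where "X \<in> \<P>" "e \<in> X" "f \<in> X"
        "r = gen (Ghost e) * gen (Edge f) - (if e = f then gen (Vert (head G e)) else 0)"
    | (CK2) X where "X \<in> \<Lambda>"
        "r = gen (Vert (block_source G X)) - (\<Sum>e\<in>X. gen (Edge e) * gen (Ghost e))"
    unfolding cl_relators_def by blast
  thus ?thesis
  proof cases
    case V
    thus ?thesis
      by (auto simp: act_simps)
  next
    case E1
    thus ?thesis
      using into by (auto simp: act_simps)
  next
    case E1'
    thus ?thesis
      by (auto simp: act_simps inv_into_into)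
  next
    case E2
    thus ?thesis
      by (auto simp: act_simps)
  next
    case E2'
    thus ?thesis
      using into by (auto simp: act_simps)
  next
    case CK1
    have ef: "e \<in> arcs G" "f \<in> arcs G" "tail G e = tail G f"
      using separated_graph_block_source(1,2)[OF sep CK1(1,2)]
        separated_graph_block_source(1,2)[OF sep CK1(1,3)] by auto
    show ?thesis
    proof (cases "e = f")
      case True
      thus ?thesis
        using ef by (auto simp: CK1(4) act_simps inv_into_f_f[OF inj_on_branch])
    next
      case False
      hence "\<theta> e i \<notin> \<theta> f ` D (head G f)" if "i \<in> D (head G e)"
        using inj[OF CK1(1-3) that] by blast
      thus ?thesis
        using ef False by (auto simp: CK1(4) act_simps)
    qed
  next
    case CK2
    have X: "X \<in> \<P>"
      using CK2 sub by blast
    have arc: "e \<in> arcs G" "tail G e = block_source G X" if "e \<in> X" for e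
      using separated_graph_block_source[OF sep X that] by auto
    have "X \<subseteq> arcs G"
      using arc by blast
    hence fin: "finite X"
      using fin_G fin_digraph.finite_arcs finite_subset by blast
    have summand: "act \<pi> (gen (Edge e) * gen (Ghost e)) x b
        = (if v = block_source G X \<and> i \<in> \<theta> e ` D (head G e) then x b else 0)" if "e \<in> X" for e
      using arc[OF that] by (auto simp: act_mult b f_inv_into_f inv_into_into)
    have "(\<Sum>e\<in>X. act \<pi> (gen (Edge e) * gen (Ghost e)) x b)
        = (if v = block_source G X \<and> i \<in> D v then x b else 0)"
    proof (cases "v = block_source G X \<and> i \<in> D v")
      case True
      then obtain e where e: "e \<in> X" "i \<in> \<theta> e ` D (head G e)"
        using onto[OF CK2(1)] by blast
      have "i \<notin> \<theta> f ` D (head G f)" if "f \<in> X" "f \<noteq> e" for f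
        using inj[OF X that(1) e(1)] e(2) that(2) by blast
      hence "(\<Sum>f\<in>X. act \<pi> (gen (Edge f) * gen (Ghost f)) x b) = (\<Sum>f\<in>X. if f = e then x b else 0)"
        using e True by (intro sum.cong refl) (auto simp: summand)
      thus ?thesis
        using e fin True by auto
    next
      case False
      have "act \<pi> (gen (Edge e) * gen (Ghost e)) x b = 0" if "e \<in> X" for e
      proof -
        have "\<theta> e ` D (head G e) \<subseteq> D (block_source G X)"
          using into[OF arc(1)[OF that]] unfolding arc(2)[OF that] by blast
        thus ?thesis
          using False by (auto simp: summand[OF that])
      qed
      thus ?thesis
        using False by auto
    qed
    thus ?thesis
      by (auto simp: CK2(2) act_diff act_sum b)
  qed
qed

text \<open>The elements of the free algebra that act as zero form an ideal, and it contains the relators.\<close>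
lemma act_cl_ideal:
  fixes p :: "(('v, 'e) cl_gen, 'k::field) ncpoly"
  assumes "p \<in> cl_ideal G \<P> \<Lambda>"
  shows "act \<pi> p x b = 0"
proof -
  let ?A = "free_algebra (cl_gens G) :: (('v, 'e) cl_gen, 'k) ncpoly ring"
  let ?N = "{p \<in> carrier ?A. \<forall>x b. act \<pi> p x b = 0}"
  interpret A: ring ?A
    by (rule ring_free_algebra)
  have A_simps: "mult ?A = (*)" "add ?A = (+)" "zero ?A = 0"
    by (simp_all add: free_algebra_def)
  have inv: "\<ominus>\<^bsub>?A\<^esub> p = - p" if "p \<in> carrier ?A" for p
    using A.minus_equality[of "- p" p] that free_algebra_closed(4)[OF that] by (simp add: A_simps)
  have "ideal ?N ?A"
  proof (rule idealI)
    show "subgroup ?N (add_monoid ?A)"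
      by (rule A.add.subgroupI)
        (auto simp: A_simps free_algebra_closed act_add act_uminus inv
          simp flip: a_inv_def intro!: exI[of _ 0])
  next
    fix p q assume p: "p \<in> ?N" and q: "q \<in> carrier ?A"
    have "act \<pi> p y = (\<lambda>b. 0)" for y
      using p by auto
    hence "act \<pi> (q * p) y b = 0" "act \<pi> (p * q) y b = 0" for y b
      by (simp_all add: act_mult)
    thus "q \<otimes>\<^bsub>?A\<^esub> p \<in> ?N" "p \<otimes>\<^bsub>?A\<^esub> q \<in> ?N"
      using p q by (simp_all add: A_simps free_algebra_closed)
  qed (rule ring_free_algebra)
  moreover have "cl_relators G \<P> \<Lambda> \<subseteq> ?N"
    using cl_relators_closed[OF sep sub] act_cl_relator by auto
  ultimately have "cl_ideal G \<P> \<Lambda> \<subseteq> ?N"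
    unfolding cl_ideal_def by (rule A.genideal_minimal)
  thus ?thesis
    using assms by blast
qed

end

section \<open>Two branching systems that differ finitely\<close>

text \<open>Keep \<open>\<theta>\<close> on the set \<open>C\<close> of points where it already maps from \<open>P'\<close> to \<open>Q'\<close>. What is left of \<open>P'\<close>
  and of \<open>Q'\<close> is finite, and the index condition says that the two leftovers have equal size: \<open>\<theta>\<close>
  itself matches the leftovers of \<open>P\<close> and \<open>Q\<close>, and passing to \<open>P'\<close> and \<open>Q'\<close> changes both sizes by
  the same amount.\<close>
lemma bij_betw_transfer:
  assumes \<theta>: "bij_betw \<theta> P Q"
    and fin: "finite (P - P')" "finite (P' - P)" "finite (Q - Q')" "finite (Q' - Q)"
    and index: "card (P - P') + card (Q' - Q) = card (P' - P) + card (Q - Q')"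
  obtains \<theta>' where "bij_betw \<theta>' P' Q'" "finite {p \<in> P \<inter> P'. \<theta> p \<noteq> \<theta>' p}"
proof -
  have inj: "inj_on \<theta> P" and img: "\<theta> ` P = Q"
    using \<theta> by (auto simp: bij_betw_def)
  define C where "C = {p \<in> P \<inter> P'. \<theta> p \<in> Q'}"
  define R where "R = P \<inter> P' - C"
  define S where "S = Q \<inter> Q' - \<theta> ` C"
  have C: "C \<subseteq> P" "C \<subseteq> P'" "\<theta> ` C \<subseteq> Q" "\<theta> ` C \<subseteq> Q'"
    using img by (auto simp: C_def)
  have "\<theta> ` R \<subseteq> Q - Q'"
    using img by (auto simp: C_def R_def)
  moreover have inj_R: "inj_on \<theta> R"
    by (rule inj_on_subset[OF inj]) (auto simp: R_def)
  ultimately have finR: "finite R"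
    using fin(3) by (meson finite_imageD finite_subset)
  have "S \<subseteq> \<theta> ` (P - P')"
    using img by (auto simp: C_def S_def)
  hence finS: "finite S"
    using fin(1) finite_surj by blast
  have split: "P - C = (P - P') \<union> R" "P' - C = (P' - P) \<union> R"
    "Q - \<theta> ` C = (Q - Q') \<union> S" "Q' - \<theta> ` C = (Q' - Q) \<union> S"
    using C by (auto simp: R_def S_def)
  have card: "card (P - C) = card (P - P') + card R" "card (P' - C) = card (P' - P) + card R"
    "card (Q - \<theta> ` C) = card (Q - Q') + card S" "card (Q' - \<theta> ` C) = card (Q' - Q) + card S"
    unfolding split using fin finR finS
    by (auto simp: R_def S_def intro!: card_Un_disjoint)
  have "\<theta> ` (P - C) = Q - \<theta> ` C"
    using inj_on_image_set_diff[OF inj, of P C] C(1) img by auto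
  hence "card (P - C) = card (Q - \<theta> ` C)"
    using card_image[OF inj_on_subset[OF inj, of "P - C"]] by auto
  hence "card (P' - C) = card (Q' - \<theta> ` C)"
    using card index by simp
  moreover have finC: "finite (P' - C)" "finite (Q' - \<theta> ` C)"
    unfolding split using fin finR finS by simp_all
  ultimately obtain h where h: "bij_betw h (P' - C) (Q' - \<theta> ` C)"
    using finite_same_card_bij by blast
  define \<theta>' where "\<theta>' p = (if p \<in> C then \<theta> p else h p)" for p
  have "bij_betw \<theta>' C (\<theta> ` C)"
    using inj_on_subset[OF inj C(1)] by (auto simp: bij_betw_def \<theta>'_def cong: inj_on_cong)
  moreover have "bij_betw \<theta>' (P' - C) (Q' - \<theta> ` C)"
    using h bij_betw_cong[of "P' - C" \<theta>' h] by (simp add: \<theta>'_def)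
  ultimately have "bij_betw \<theta>' (C \<union> (P' - C)) (\<theta> ` C \<union> (Q' - \<theta> ` C))"
    by (rule bij_betw_combine) auto
  moreover have "C \<union> (P' - C) = P'" "\<theta> ` C \<union> (Q' - \<theta> ` C) = Q'"
    using C by auto
  ultimately have "bij_betw \<theta>' P' Q'"
    by simp
  moreover have "finite {p \<in> P \<inter> P'. \<theta> p \<noteq> \<theta>' p}"
    by (rule finite_subset[OF _ finC(1)]) (auto simp: \<theta>'_def)
  ultimately show ?thesis
    by (rule that)
qed

lemma half_line_diff:
  fixes c d :: int
  shows "{c..} - {d..} = {c..<d}"
  by auto

text \<open>A half line \<open>{d..}\<close> of integers is an infinite set with a prescribed index \<open>-d\<close> relative to \<open>{0..}\<close>,
  of either sign. The second bijection exists because indices add up over the disjoint union.\<close>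
lemma half_lines_bij_pair:
  fixes d :: "'e \<Rightarrow> int" and a :: int
  assumes X: "finite X" "X \<noteq> {}"
  obtains \<theta> \<theta>' where
    "bij_betw \<theta> (SIGMA e:X. {0..}) {a..}"
    "bij_betw \<theta>' (SIGMA e:X. {d e..}) {a + sum d X..}"
    "finite {p \<in> (SIGMA e:X. {0..}) \<inter> (SIGMA e:X. {d e..}). \<theta> p \<noteq> \<theta>' p}"
proof -
  let ?P = "SIGMA e:X. {0::int..}" and ?P' = "SIGMA e:X. {d e..}"
  let ?Q = "{a..}" and ?Q' = "{a + sum d X..}"
  have "countable ?P" "infinite ?P" "countable ?Q" "infinite ?Q"
    using X by (auto simp: countable_finite finite_SigmaI2 infinite_Ici intro!: countable_SIGMA dest: finite_cartesian_productD2)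
  then obtain f g where "bij_betw f ?P (UNIV :: nat set)" "bij_betw g ?Q (UNIV :: nat set)"
    by (metis countableE_infinite)
  hence \<theta>: "bij_betw (inv_into ?Q g \<circ> f) ?P ?Q"
    using bij_betw_trans bij_betw_inv_into by blast
  have diff: "?P - ?P' = (SIGMA e:X. {0..<d e})" "?P' - ?P = (SIGMA e:X. {d e..<0})"
    by auto
  have fin: "finite (?P - ?P')" "finite (?P' - ?P)"
    unfolding diff using X by simp_all
  have card: "card (?P - ?P') = (\<Sum>e\<in>X. nat (d e))" "card (?P' - ?P) = (\<Sum>e\<in>X. nat (- d e))"
    unfolding diff using X by simp_all
  have "int (card (?P - ?P')) - int (card (?P' - ?P)) = (\<Sum>e\<in>X. int (nat (d e)) - int (nat (- d e)))"
    unfolding card by (simp add: sum_subtractf)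
  also have "\<dots> = sum d X"
    by (rule sum.cong) auto
  also have "\<dots> = int (card (?Q - ?Q')) - int (card (?Q' - ?Q))"
    by (simp add: half_line_diff)
  finally have "card (?P - ?P') + card (?Q' - ?Q) = card (?P' - ?P) + card (?Q - ?Q')"
    by linarith
  moreover have "finite (?Q - ?Q')" "finite (?Q' - ?Q)"
    by (simp_all add: half_line_diff)
  ultimately obtain \<theta>' where "bij_betw \<theta>' ?P' ?Q'"
      "finite {p \<in> ?P \<inter> ?P'. (inv_into ?Q g \<circ> f) p \<noteq> \<theta>' p}"
    using bij_betw_transfer[OF \<theta> fin] by blast
  with \<theta> show ?thesis
    by (rule that)
qed

text \<open>Each block is treated separately: it needs injections out of the disjoint union of the point sets at
  its targets, one for each of the two systems, that differ at finitely many points only.\<close>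
lemma branching_system_pair:
  fixes G :: "('v, 'e) pre_digraph" and \<phi> :: "'v \<Rightarrow> int"
  assumes fin: "fin_digraph G" and sep: "separated_graph G \<P>" and sub: "\<Lambda> \<subseteq> \<P>"
    and \<phi>: "\<And>X. X \<in> \<Lambda> \<Longrightarrow> \<phi> (block_source G X) = (\<Sum>e\<in>X. \<phi> (head G e))"
  obtains \<theta> \<theta>' where
    "branching_system G \<P> \<Lambda> (\<lambda>v. {0..}) \<theta>" "branching_system G \<P> \<Lambda> (\<lambda>v. {\<phi> v..}) \<theta>'"
    "\<And>e. e \<in> arcs G \<Longrightarrow> finite {i \<in> {0..} \<inter> {\<phi> (head G e)..}. \<theta> e i \<noteq> \<theta>' e i}"
proof -
  define d where "d e = \<phi> (head G e)" for e
  \<comment> \<open>The block \<open>X\<close> is mapped onto the half lines from \<open>a X\<close> and from \<open>a X + sum d X\<close>. For \<open>X \<in> \<Lambda>\<close>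
    these have to be all of \<open>{0..}\<close> and \<open>{\<phi> (block_source G X)..}\<close>, which is consistent by the
    assumption on \<open>\<phi>\<close>. For the other blocks it is enough to lie inside these two half lines, and any
    sufficiently large \<open>a X\<close> will do.\<close>
  define a where "a X = (if X \<in> \<Lambda> then 0 else \<bar>\<phi> (block_source G X)\<bar> + \<bar>sum d X\<bar>)" for X
  have part: "partition_on (arcs G) \<P>"
    using sep by (simp add: separated_graph_def refines_def)
  have X: "finite X" "X \<noteq> {}" if "X \<in> \<P>" for X
    using that part fin_digraph.finite_arcs[OF fin] finite_subset[of X "arcs G"]
    by (auto simp: partition_on_def)
  have "\<forall>X\<in>\<P>. \<exists>h. bij_betw (fst h) (SIGMA e:X. {0..}) {a X..}
      \<and> bij_betw (snd h) (SIGMA e:X. {d e..}) {a X + sum d X..}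
      \<and> finite {p \<in> (SIGMA e:X. {0..}) \<inter> (SIGMA e:X. {d e..}). fst h p \<noteq> snd h p}"
  proof
    fix X assume "X \<in> \<P>"
    from half_lines_bij_pair[OF X[OF this], where d = d and a = "a X"] obtain \<theta> \<theta>' where
      "bij_betw \<theta> (SIGMA e:X. {0..}) {a X..}" "bij_betw \<theta>' (SIGMA e:X. {d e..}) {a X + sum d X..}"
      "finite {p \<in> (SIGMA e:X. {0..}) \<inter> (SIGMA e:X. {d e..}). \<theta> p \<noteq> \<theta>' p}"
      by blast
    thus "\<exists>h. bij_betw (fst h) (SIGMA e:X. {0..}) {a X..}
        \<and> bij_betw (snd h) (SIGMA e:X. {d e..}) {a X + sum d X..}
        \<and> finite {p \<in> (SIGMA e:X. {0..}) \<inter> (SIGMA e:X. {d e..}). fst h p \<noteq> snd h p}"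
      by (intro exI[of _ "(\<theta>, \<theta>')"]) simp
  qed
  from bchoice[OF this] obtain h where
    h: "\<And>X. X \<in> \<P> \<Longrightarrow> bij_betw (fst (h X)) (SIGMA e:X. {0..}) {a X..}"
      "\<And>X. X \<in> \<P> \<Longrightarrow> bij_betw (snd (h X)) (SIGMA e:X. {d e..}) {a X + sum d X..}"
      "\<And>X. X \<in> \<P> \<Longrightarrow>
        finite {p \<in> (SIGMA e:X. {0..}) \<inter> (SIGMA e:X. {d e..}). fst (h X) p \<noteq> snd (h X) p}"
    by blast
  define block where "block e = (THE X. X \<in> \<P> \<and> e \<in> X)" for e
  have block_eq: "block e = X" if "X \<in> \<P>" "e \<in> X" for e X
    unfolding block_def
  proof (rule the_equality)
    fix Y assume "Y \<in> \<P> \<and> e \<in> Y"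
    thus "Y = X"
      using that disjointD[OF partition_onD2[OF part], of X Y] by blast
  qed (use that in blast)
  have block: "block e \<in> \<P>" "e \<in> block e" if "e \<in> arcs G" for e
  proof -
    have "e \<in> \<Union>\<P>"
      using part that by (simp add: partition_on_def)
    thus "block e \<in> \<P>" "e \<in> block e"
      using block_eq by auto
  qed
  have bounds: "0 \<le> a X" "\<phi> (block_source G X) \<le> a X + sum d X" for X
    using \<phi>[of X] by (auto simp: a_def d_def)
  have exact: "a X = 0" "a X + sum d X = \<phi> (block_source G X)" if "X \<in> \<Lambda>" for X
    using \<phi>[OF that] that by (auto simp: a_def d_def)
  have branching: "branching_system G \<P> \<Lambda> D (\<lambda>e i. \<eta> (block e) (e, i))"
    if \<eta>: "\<And>X. X \<in> \<P> \<Longrightarrow> bij_betw (\<eta> X) (SIGMA e:X. D (head G e)) (B X)"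
      and B: "\<And>X. X \<in> \<P> \<Longrightarrow> B X \<subseteq> D (block_source G X)"
      "\<And>X. X \<in> \<Lambda> \<Longrightarrow> B X = D (block_source G X)"
    for \<eta> :: "'e set \<Rightarrow> 'e \<times> int \<Rightarrow> int" and D B
  proof (rule branching_system.intro)
    show "fin_digraph G" "separated_graph G \<P>" "\<Lambda> \<subseteq> \<P>"
      by fact+
  next
    fix e i assume e: "e \<in> arcs G" "i \<in> D (head G e)"
    have "\<eta> (block e) (e, i) \<in> B (block e)"
      using bij_betwE[OF \<eta>[OF block(1)[OF e(1)]]] block(2)[OF e(1)] e(2) by blast
    thus "\<eta> (block e) (e, i) \<in> D (tail G e)"
      using B(1)[OF block(1)[OF e(1)]] separated_graph_block_source(2)[OF sep block[OF e(1)]] by auto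
  next
    fix X e f i j
    assume *: "X \<in> \<P>" "e \<in> X" "f \<in> X" "i \<in> D (head G e)" "j \<in> D (head G f)"
      "\<eta> (block e) (e, i) = \<eta> (block f) (f, j)"
    hence "\<eta> X (e, i) = \<eta> X (f, j)"
      by (simp add: block_eq)
    hence "(e, i) = (f, j)"
      using * by (intro inj_onD[OF bij_betw_imp_inj_on[OF \<eta>[OF *(1)]]]) auto
    thus "e = f \<and> i = j"
      by simp
  next
    fix X j assume *: "X \<in> \<Lambda>" "j \<in> D (block_source G X)"
    hence "X \<in> \<P>"
      using sub by blast
    then obtain e i where "e \<in> X" "i \<in> D (head G e)" "j = \<eta> X (e, i)"
      using bij_betw_imp_surj_on[OF \<eta>] B(2)[OF *(1)] *(2) by blast
    thus "\<exists>e\<in>X. j \<in> (\<lambda>i. \<eta> (block e) (e, i)) ` D (head G e)"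
      using block_eq[OF \<open>X \<in> \<P>\<close>] by auto
  qed
  show ?thesis
  proof (rule that)
    show "branching_system G \<P> \<Lambda> (\<lambda>v. {0..}) (\<lambda>e i. fst (h (block e)) (e, i))"
      by (rule branching[where B = "\<lambda>X. {a X..}"]) (use h(1) bounds exact in auto)
    show "branching_system G \<P> \<Lambda> (\<lambda>v. {\<phi> v..}) (\<lambda>e i. snd (h (block e)) (e, i))"
      by (rule branching[where B = "\<lambda>X. {a X + sum d X..}"])
        (use h(2) bounds exact in \<open>auto simp: d_def\<close>)
  next
    fix e assume e: "e \<in> arcs G"
    let ?F = "{p \<in> (SIGMA e:block e. {0..}) \<inter> (SIGMA e:block e. {d e..}).
      fst (h (block e)) p \<noteq> snd (h (block e)) p}"
    show "finite {i \<in> {0..} \<inter> {\<phi> (head G e)..}.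
        fst (h (block e)) (e, i) \<noteq> snd (h (block e)) (e, i)}"
    proof (rule finite_subset)
      show "finite (snd ` ?F)"
        using h(3)[OF block(1)[OF e]] by blast
      show "{i \<in> {0..} \<inter> {\<phi> (head G e)..}.
          fst (h (block e)) (e, i) \<noteq> snd (h (block e)) (e, i)} \<subseteq> snd ` ?F"
        using block(2)[OF e] by (force simp: d_def)
    qed
  qed
qed

text \<open>For an edge, the value at a point \<open>j\<close> is decided by the \<open>i\<close> with \<open>\<theta> e i = j\<close>. If \<open>j\<close> is not the
  image of one of the finitely many \<open>i\<close> where the point sets or the injections differ, both systems
  find the same \<open>i\<close>, or none.\<close>
lemma finite_disagreement_branch_map:
  assumes "branching_system G \<P> \<Lambda> D \<theta>" "branching_system G \<P> \<Lambda> D' \<theta>'"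
    and fin_D: "\<And>v. finite (D v - D' v)" "\<And>v. finite (D' v - D v)"
    and fin_\<theta>: "\<And>e. e \<in> arcs G \<Longrightarrow> finite {i \<in> D (head G e) \<inter> D' (head G e). \<theta> e i \<noteq> \<theta>' e i}"
  shows "finite {b. branch_map G D \<theta> g b \<noteq> branch_map G D' \<theta>' g b}"
proof -
  interpret B: branching_system G \<P> \<Lambda> D \<theta> by fact
  interpret B': branching_system G \<P> \<Lambda> D' \<theta>' by fact
  define E where "E v = (D v - D' v) \<union> (D' v - D v)" for v
  define F where "F e = E (head G e) \<union> {i \<in> D (head G e) \<inter> D' (head G e). \<theta> e i \<noteq> \<theta>' e i}" for e
  have E: "finite (E v)" for v
    using fin_D by (simp add: E_def)
  have F: "finite (F e)" if "e \<in> arcs G" for e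
    using E fin_\<theta>[OF that] by (simp add: F_def)
  show ?thesis
  proof (cases g)
    case (Vert w)
    have "{b. B.\<pi> g b \<noteq> B'.\<pi> g b} \<subseteq> Pair w ` E w"
      by (auto simp: Vert E_def split: if_splits)
    thus ?thesis
      using E finite_subset by blast
  next
    case (Ghost e)
    show ?thesis
    proof (cases "e \<in> arcs G")
      case True
      have "{b. B.\<pi> g b \<noteq> B'.\<pi> g b} \<subseteq> Pair (head G e) ` F e"
        by (auto simp: Ghost E_def F_def split: if_splits)
      thus ?thesis
        using F[OF True] finite_subset by blast
    next
      case False
      have "B.\<pi> g b = B'.\<pi> g b" for b
        by (cases b) (simp add: Ghost False)
      thus ?thesis
        by simp
    qed
  next
    case (Edge e)
    show ?thesis
    proof (cases "e \<in> arcs G")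
      case True
      note inv = inv_into_f_f[OF B.inj_on_branch[OF True]] inv_into_f_f[OF B'.inj_on_branch[OF True]]
      have agree: "\<theta> e i = \<theta>' e i" "i \<in> D (head G e) \<longleftrightarrow> i \<in> D' (head G e)"
        if "i \<in> D (head G e) \<union> D' (head G e)" "i \<notin> F e" for i
        using that by (auto simp: F_def E_def)
      have "{b. B.\<pi> g b \<noteq> B'.\<pi> g b} \<subseteq> Pair (tail G e) ` (\<theta> e ` F e \<union> \<theta>' e ` F e)"
      proof
        fix b assume b: "b \<in> {b. B.\<pi> g b \<noteq> B'.\<pi> g b}"
        obtain v j where vj: "b = (v, j)"
          by fastforce
        have v: "v = tail G e"
          using b by (auto simp: Edge vj split: if_splits)
        have "j \<in> \<theta> e ` F e \<union> \<theta>' e ` F e"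
        proof (rule ccontr)
          assume j: "\<not> ?thesis"
          have "B.\<pi> g b = B'.\<pi> g b"
          proof (cases "j \<in> \<theta> e ` D (head G e)")
            case True
            then obtain i where i: "i \<in> D (head G e)" "j = \<theta> e i"
              by blast
            hence i': "i \<in> D' (head G e)" "j = \<theta>' e i"
              using j agree[of i] by auto
            have "inv_into (D (head G e)) (\<theta> e) j = i" "inv_into (D' (head G e)) (\<theta>' e) j = i"
              using inv(1)[OF i(1)] inv(2)[OF i'(1)] i(2) i'(2) by simp_all
            moreover have "j \<in> \<theta>' e ` D' (head G e)"
              using i' by blast
            ultimately show ?thesis
              using True by (simp add: Edge vj)
          next
            case False
            have "j \<notin> \<theta>' e ` D' (head G e)"
            proof
              assume "j \<in> \<theta>' e ` D' (head G e)"
              then obtain i where i: "i \<in> D' (head G e)" "j = \<theta>' e i"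
                by blast
              moreover have "i \<notin> F e"
                using i(2) j by blast
              ultimately have "i \<in> D (head G e)" "j = \<theta> e i"
                using agree[of i] by simp_all
              with False show False
                by blast
            qed
            thus ?thesis
              using False by (simp add: Edge vj)
          qed
          thus False
            using b by simp
        qed
        thus "b \<in> Pair (tail G e) ` (\<theta> e ` F e \<union> \<theta>' e ` F e)"
          by (simp add: vj v)
      qed
      thus ?thesis
        by (rule finite_subset) (intro finite_imageI finite_UnI F[OF True])
    next
      case False
      have "B.\<pi> g b = B'.\<pi> g b" for b
        by (cases b) (simp add: Edge False)
      thus ?thesis
        by simp
    qed
  qed
qed

section \<open>Corner matrices on a branching system\<close>

definition vertex_sum :: "'v set \<Rightarrow> (('v, 'e) cl_gen, 'k::field) ncpoly" where
  "vertex_sum H = (\<Sum>v\<in>H. gen (Vert v))"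

context branching_system
begin

lemma act_vertex_sum:
  assumes "finite H"
  shows "act \<pi> (vertex_sum H :: (('v, 'e) cl_gen, 'k::field) ncpoly) x b
    = (if b \<in> Sigma H D then x b else 0)"
proof -
  obtain v i where b: "b = (v, i)"
    by fastforce
  have "act \<pi> (vertex_sum H :: (('v, 'e) cl_gen, 'k) ncpoly) x b
      = (\<Sum>w\<in>H. if v = w then (if i \<in> D v then x b else 0) else 0)"
    unfolding vertex_sum_def act_sum by (rule sum.cong) (auto simp: b)
  thus ?thesis
    using assms by (simp add: b)
qed

lemma mat_act_inverse:
  fixes M N :: "nat \<Rightarrow> nat \<Rightarrow> (('v, 'e) cl_gen, 'k::field) ncpoly"
  assumes H: "finite H"
    and MN: "\<And>i k. i < n \<Longrightarrow> k < n \<Longrightarrow>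
      (\<Sum>j<m. M i j * N j k) - (if i = k then vertex_sum H else 0) \<in> cl_ideal G \<P> \<Lambda>"
    and x: "x \<in> fin_supported ({..<n} \<times> Sigma H D)"
  shows "mat_act \<pi> n m M (mat_act \<pi> m n N x) = x"
proof
  fix c :: "nat \<times> 'v \<times> 'b"
  obtain i b where c: "c = (i, b)"
    by (cases c)
  have "mat_act \<pi> n m M (mat_act \<pi> m n N x) c
      = (if i < n then \<Sum>k<n. act \<pi> (\<Sum>j<m. M i j * N j k) (\<lambda>b. x (k, b)) b else 0)"
    by (simp add: mat_act_mult) (simp add: mat_act_def c)
  also have "\<dots> = (if i < n then \<Sum>k<n. if i = k then (if b \<in> Sigma H D then x (k, b) else 0) else 0 else 0)"
  proof (intro if_cong sum.cong refl)
    fix k assume "i < n" "k \<in> {..<n}"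
    hence "act \<pi> ((\<Sum>j<m. M i j * N j k) - (if i = k then vertex_sum H else 0)) (\<lambda>b. x (k, b)) b = 0"
      by (intro act_cl_ideal MN) auto
    thus "act \<pi> (\<Sum>j<m. M i j * N j k) (\<lambda>b. x (k, b)) b
        = (if i = k then (if b \<in> Sigma H D then x (k, b) else 0) else 0)"
      by (simp add: act_diff act_vertex_sum[OF H] split: if_splits)
  qed
  also have "\<dots> = x c"
    using x by (auto simp: c fin_supported_def)
  finally show "mat_act \<pi> n m M (mat_act \<pi> m n N x) c = x c" .
qed

text \<open>The left factor \<open>vertex_sum H\<close> acts as the projection to the functions supported over \<open>H\<close>.\<close>
lemma mat_act_into_corner:
  fixes M :: "nat \<Rightarrow> nat \<Rightarrow> (('v, 'e) cl_gen, 'k::field) ncpoly"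
  assumes H: "finite H"
    and M: "\<And>i j. i < n \<Longrightarrow> j < m \<Longrightarrow> \<exists>p. M i j = vertex_sum H * p"
    and x: "finite {c. x c \<noteq> 0}"
  shows "mat_act \<pi> n m M x \<in> fin_supported ({..<n} \<times> Sigma H D)"
  unfolding fin_supported_def
proof (intro CollectI conjI)
  show "finite {c. mat_act \<pi> n m M x c \<noteq> 0}"
    by (intro finite_support_mat_act finite_to_one_branch_map x)
  show "{c. mat_act \<pi> n m M x c \<noteq> 0} \<subseteq> {..<n} \<times> Sigma H D"
  proof
    fix c assume c: "c \<in> {c. mat_act \<pi> n m M x c \<noteq> 0}"
    obtain i b where ib: "c = (i, b)"
      by (cases c)
    have i: "i < n" and "(\<Sum>j<m. act \<pi> (M i j) (\<lambda>b. x (j, b)) b) \<noteq> 0"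
      using c by (auto simp: ib mat_act_def split: if_splits)
    then obtain j where j: "j < m" "act \<pi> (M i j) (\<lambda>b. x (j, b)) b \<noteq> 0"
      by (metis (mono_tags, lifting) lessThan_iff sum.neutral)
    obtain p where "M i j = vertex_sum H * p"
      using M[OF i j(1)] by blast
    hence "b \<in> Sigma H D"
      using j(2) by (auto simp: act_mult act_vertex_sum[OF H] split: if_splits)
    thus "c \<in> {..<n} \<times> Sigma H D"
      using i by (simp add: ib)
  qed
qed

lemma bij_betw_mat_act:
  fixes M N :: "nat \<Rightarrow> nat \<Rightarrow> (('v, 'e) cl_gen, 'k::field) ncpoly"
  assumes H: "finite H"
    and M: "\<And>i j. i < n \<Longrightarrow> j < m \<Longrightarrow> \<exists>p. M i j = vertex_sum H * p"
    and N: "\<And>i j. i < n \<Longrightarrow> j < m \<Longrightarrow> \<exists>p. N j i = vertex_sum H * p"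
    and MN: "\<And>i k. i < n \<Longrightarrow> k < n \<Longrightarrow>
      (\<Sum>j<m. M i j * N j k) - (if i = k then vertex_sum H else 0) \<in> cl_ideal G \<P> \<Lambda>"
    and NM: "\<And>i k. i < m \<Longrightarrow> k < m \<Longrightarrow>
      (\<Sum>j<n. N i j * M j k) - (if i = k then vertex_sum H else 0) \<in> cl_ideal G \<P> \<Lambda>"
  shows "bij_betw (mat_act \<pi> n m M)
    (fin_supported ({..<m} \<times> Sigma H D)) (fin_supported ({..<n} \<times> Sigma H D))"
proof (rule bij_betw_byWitness[where f' = "mat_act \<pi> m n N"])
  show "\<forall>x\<in>fin_supported ({..<m} \<times> Sigma H D). mat_act \<pi> m n N (mat_act \<pi> n m M x) = x"
    "\<forall>y\<in>fin_supported ({..<n} \<times> Sigma H D). mat_act \<pi> n m M (mat_act \<pi> m n N y) = y"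
    using mat_act_inverse[OF H NM] mat_act_inverse[OF H MN] by blast+
  show "mat_act \<pi> n m M ` fin_supported ({..<m} \<times> Sigma H D) \<subseteq> fin_supported ({..<n} \<times> Sigma H D)"
    by (intro image_subsetI mat_act_into_corner H M) (auto simp: fin_supported_def)
  show "mat_act \<pi> m n N ` fin_supported ({..<n} \<times> Sigma H D) \<subseteq> fin_supported ({..<m} \<times> Sigma H D)"
    by (intro image_subsetI mat_act_into_corner H N) (auto simp: fin_supported_def)
qed

end

text \<open>Over \<open>H\<close> the point sets of the two systems have relative size \<open>\<phi>(H)\<close>, so \<open>m\<close> copies have relative
  size \<open>m \<cdot> \<phi>(H)\<close>; isomorphisms that agree almost everywhere transport this number.\<close>
lemma corner_matrices_index:
  fixes M N :: "nat \<Rightarrow> nat \<Rightarrow> (('v, 'e) cl_gen, 'k::field) ncpoly" and \<phi> :: "'v \<Rightarrow> int"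
  assumes G: "fin_digraph G" "separated_graph G \<P>" "\<Lambda> \<subseteq> \<P>" and H: "finite H"
    and \<phi>: "\<And>X. X \<in> \<Lambda> \<Longrightarrow> \<phi> (block_source G X) = (\<Sum>e\<in>X. \<phi> (head G e))"
    and M: "\<And>i j. i < n \<Longrightarrow> j < m \<Longrightarrow> \<exists>p. M i j = vertex_sum H * p"
    and N: "\<And>i j. i < n \<Longrightarrow> j < m \<Longrightarrow> \<exists>p. N j i = vertex_sum H * p"
    and MN: "\<And>i k. i < n \<Longrightarrow> k < n \<Longrightarrow>
      (\<Sum>j<m. M i j * N j k) - (if i = k then vertex_sum H else 0) \<in> cl_ideal G \<P> \<Lambda>"
    and NM: "\<And>i k. i < m \<Longrightarrow> k < m \<Longrightarrow>
      (\<Sum>j<n. N i j * M j k) - (if i = k then vertex_sum H else 0) \<in> cl_ideal G \<P> \<Lambda>"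
  shows "int m * (\<Sum>v\<in>H. \<phi> v) = int n * (\<Sum>v\<in>H. \<phi> v)"
proof -
  let ?D = "\<lambda>v::'v. {0::int..}" and ?D' = "\<lambda>v. {\<phi> v..}"
  obtain \<theta> \<theta>' where bs: "branching_system G \<P> \<Lambda> ?D \<theta>" "branching_system G \<P> \<Lambda> ?D' \<theta>'"
    and agree: "\<And>e. e \<in> arcs G \<Longrightarrow> finite {i \<in> ?D (head G e) \<inter> ?D' (head G e). \<theta> e i \<noteq> \<theta>' e i}"
    using branching_system_pair[OF G \<phi>] by blast
  interpret B: branching_system G \<P> \<Lambda> ?D \<theta> by fact
  interpret B': branching_system G \<P> \<Lambda> ?D' \<theta>' by fact
  let ?P = "\<lambda>k. {..<k::nat} \<times> Sigma H ?D" and ?P' = "\<lambda>k. {..<k::nat} \<times> Sigma H ?D'"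
  have diff: "?P k - ?P' k = {..<k} \<times> (SIGMA v:H. {0..<\<phi> v})"
    "?P' k - ?P k = {..<k} \<times> (SIGMA v:H. {\<phi> v..<0})" for k
    by auto
  have fin: "finite (?P k - ?P' k)" "finite (?P' k - ?P k)" for k
    unfolding diff using H by simp_all
  have "finite {b. B.\<pi> g b \<noteq> B'.\<pi> g b}" for g
    by (rule finite_disagreement_branch_map[OF bs _ _ agree]) (simp_all add: half_line_diff)
  hence "finite {c. mat_act B.\<pi> n m M (delta c) \<noteq> mat_act B'.\<pi> n m M (delta c)}"
    by (intro finite_disagreement_mat_act B.finite_to_one_branch_map B'.finite_to_one_branch_map)
  hence "card (?P m - ?P' m) + card (?P' n - ?P n) = card (?P' m - ?P m) + card (?P n - ?P' n)"
    by (intro index_eq_of_commensurable_isos[OF linear_mat_act linear_mat_act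
          B.bij_betw_mat_act[OF H M N MN NM] B'.bij_betw_mat_act[OF H M N MN NM]] fin)
  hence "m * (\<Sum>v\<in>H. nat (\<phi> v)) + n * (\<Sum>v\<in>H. nat (- \<phi> v))
      = m * (\<Sum>v\<in>H. nat (- \<phi> v)) + n * (\<Sum>v\<in>H. nat (\<phi> v))"
    unfolding diff using H by (simp add: card_cartesian_product)
  from arg_cong[OF this, of int] have "int m * (\<Sum>v\<in>H. int (nat (\<phi> v))) + int n * (\<Sum>v\<in>H. int (nat (- \<phi> v)))
      = int m * (\<Sum>v\<in>H. int (nat (- \<phi> v))) + int n * (\<Sum>v\<in>H. int (nat (\<phi> v)))"
    by (simp only: of_nat_add of_nat_mult of_nat_sum)
  moreover have "(\<Sum>v\<in>H. \<phi> v) = (\<Sum>v\<in>H. int (nat (\<phi> v))) - (\<Sum>v\<in>H. int (nat (- \<phi> v)))"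
    unfolding sum_subtractf[symmetric] by (rule sum.cong) auto
  ultimately show ?thesis
    by (simp only: right_diff_distrib)
qed

section \<open>An integral functional\<close>

lemma common_denominator:
  fixes f :: "'a \<Rightarrow> rat"
  assumes "finite A"
  shows "\<exists>d::int. d \<noteq> 0 \<and> (\<forall>a\<in>A. of_int d * f a \<in> \<int>)"
  using assms
proof induction
  case (insert a A)
  then obtain d :: int where d: "d \<noteq> 0" "\<forall>a\<in>A. of_int d * f a \<in> \<int>"
    by blast
  obtain p q :: int where pq: "f a = of_int p / of_int q" "q \<noteq> 0"
    by (metis quotient_of_div quotient_of_denom_pos prod.collapse less_irrefl)
  have "of_int (q * d) * f b \<in> \<int>" if "b \<in> insert a A" for b
  proof (cases "b = a")
    case True
    thus ?thesis
      using pq by simp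
  next
    case False
    hence "of_int d * f b \<in> \<int>"
      using d(2) that by simp
    hence "of_int q * (of_int d * f b) \<in> \<int>"
      by (rule Ints_mult[OF Ints_of_int])
    thus ?thesis
      by (simp add: mult.assoc)
  qed
  thus ?case
    using d(1) pq(2) by (metis mult_eq_0_iff)
qed (auto intro: exI[of _ 1])

text \<open>A vector outside a subspace is separated from it by a linear functional. Only finitely many values
  matter, so they have a common denominator.\<close>
lemma integral_functional:
  fixes G :: "('v, 'e) pre_digraph"
  assumes G: "fin_digraph G" "separated_graph G \<P>" "\<Lambda> \<subseteq> \<P>" and H: "H \<subseteq> verts G"
    and nspan: "(\<Sum>v\<in>H. vert_basis v) \<notin> module.span rat_scale (block_vector G ` \<Lambda>)"
  obtains \<phi> :: "'v \<Rightarrow> int" where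
    "\<And>X. X \<in> \<Lambda> \<Longrightarrow> \<phi> (block_source G X) = (\<Sum>e\<in>X. \<phi> (head G e))" "(\<Sum>v\<in>H. \<phi> v) \<noteq> 0"
proof -
  interpret Q: vector_space "rat_scale :: rat \<Rightarrow> ('v + 'e set \<Rightarrow>\<^sub>0 rat) \<Rightarrow> _"
    by (rule vector_space_rat_scale)
  interpret R: vector_space "(*) :: rat \<Rightarrow> rat \<Rightarrow> rat"
    by unfold_locales (simp_all add: algebra_simps)
  interpret QR: vector_space_pair "rat_scale :: rat \<Rightarrow> ('v + 'e set \<Rightarrow>\<^sub>0 rat) \<Rightarrow> _" "(*)" ..
  let ?\<alpha> = "\<Sum>v\<in>H. vert_basis v :: 'v + 'e set \<Rightarrow>\<^sub>0 rat"
  obtain B where B: "B \<subseteq> block_vector G ` \<Lambda>" "Q.independent B" "block_vector G ` \<Lambda> \<subseteq> Q.span B"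
    using Q.maximal_independent_subset by blast
  have \<alpha>: "?\<alpha> \<notin> Q.span B"
    using nspan Q.span_mono[OF B(1)] by blast
  hence "Q.independent (insert ?\<alpha> B)"
    using B(2) by (simp add: Q.independent_insert)
  from QR.linear_independent_extend[OF this, of "\<lambda>x. if x = ?\<alpha> then 1 else 0"] obtain g where
    g: "Vector_Spaces.linear rat_scale (*) g"
      "\<forall>x\<in>insert ?\<alpha> B. g x = (if x = ?\<alpha> then 1 else 0)"
    by blast
  interpret g: Vector_Spaces.linear rat_scale "(*)" g by (rule g(1))
  have "g b = 0" if "b \<in> B" for b
    using g(2) that \<alpha> Q.span_base[of b B] by auto
  hence g_span: "g x = 0" if "x \<in> Q.span B" for x
    using g.eq_0_on_span that by blast
  have g_block: "g (vert_basis (block_source G X)) = (\<Sum>e\<in>X. g (vert_basis (head G e)))"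
    if "X \<in> \<Lambda>" for X
    using g_span[of "block_vector G X"] B(3) that
    by (auto simp: block_vector_def g.diff g.sum)
  have g_H: "(\<Sum>v\<in>H. g (vert_basis v)) = 1"
    using g(2) by (simp add: g.sum)
  have "finite (verts G)"
    using G(1) fin_digraph.finite_verts by blast
  then obtain d :: int where d: "d \<noteq> 0" "\<forall>v\<in>verts G. of_int d * g (vert_basis v) \<in> \<int>"
    using common_denominator[OF \<open>finite (verts G)\<close>, of "\<lambda>v. g (vert_basis v)"] by blast
  define \<phi> where "\<phi> v = \<lfloor>of_int d * g (vert_basis v)\<rfloor>" for v
  have \<phi>: "of_int (\<phi> v) = of_int d * g (vert_basis v)" if "v \<in> verts G" for v
    using d(2) that by (simp add: \<phi>_def)
  show ?thesis
  proof (rule that)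
    fix X assume X: "X \<in> \<Lambda>"
    have src: "block_source G X \<in> verts G" "X \<subseteq> arcs G"
      using block_source_in_verts[OF G(2)] G(3) X by auto
    have hd: "head G e \<in> verts G" if "e \<in> X" for e
      using G(2) src(2) that by (auto simp: separated_graph_def wf_digraph.head_in_verts)
    have "(of_int (\<phi> (block_source G X)) :: rat) = of_int (\<Sum>e\<in>X. \<phi> (head G e))"
      using g_block[OF X] by (simp add: \<phi> src hd sum_distrib_left)
    thus "\<phi> (block_source G X) = (\<Sum>e\<in>X. \<phi> (head G e))"
      by (simp only: of_int_eq_iff)
  next
    have "(of_int (\<Sum>v\<in>H. \<phi> v) :: rat) = of_int d * (\<Sum>v\<in>H. g (vert_basis v))"
      using H by (simp add: sum_distrib_left \<phi> subset_iff)
    hence "(of_int (\<Sum>v\<in>H. \<phi> v) :: rat) \<noteq> 0"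
      using d(1) g_H by simp
    thus "(\<Sum>v\<in>H. \<phi> v) \<noteq> 0"
      by (metis of_int_0)
  qed
qed

section \<open>Matrices of isomorphisms between free modules\<close>

definition unit_vector :: "('a, 'm) ring_scheme \<Rightarrow> nat \<Rightarrow> nat \<Rightarrow> nat \<Rightarrow> 'a" where
  "unit_vector R m j = (\<lambda>i\<in>{..<m}. if i = j then \<one>\<^bsub>R\<^esub> else \<zero>\<^bsub>R\<^esub>)"

text \<open>The vector \<open>x\<close> is built up coordinate by coordinate, since only binary additivity of \<open>f\<close> is given.\<close>
lemma right_module_iso_expansion:
  fixes R (structure)
  assumes "ring R" and f: "right_module_iso R m n f"
    and x: "x \<in> free_module R m" and i: "i < n"
  shows "f x i = (\<Oplus>j\<in>{..<m}. f (unit_vector R m j) i \<otimes> x j)"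
proof -
  interpret ring R by fact
  note f_iso = f[unfolded right_module_iso_def]
  have f_add: "f (\<lambda>i\<in>{..<m}. y i \<oplus> z i) = (\<lambda>i\<in>{..<n}. f y i \<oplus> f z i)"
    if "y \<in> free_module R m" "z \<in> free_module R m" for y z
    using f_iso that by blast
  have f_smult: "f (\<lambda>i\<in>{..<m}. y i \<otimes> r) = (\<lambda>i\<in>{..<n}. f y i \<otimes> r)"
    if "y \<in> free_module R m" "r \<in> carrier R" for y r
    using f_iso that by blast
  have f_closed: "f y i \<in> carrier R" if "y \<in> free_module R m" for y
    using bij_betwE[of f "free_module R m" "free_module R n"] f_iso that i
    by (auto simp: free_module_def PiE_iff)
  have e: "unit_vector R m j \<in> free_module R m" for j
    by (auto simp: unit_vector_def free_module_def)
  have xc: "x j \<in> carrier R" if "j < m" for j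
    using x that by (auto simp: free_module_def)
  define t where "t k = (\<lambda>i\<in>{..<m}. if i < k then x i else \<zero>)" for k :: nat
  have t: "t k \<in> free_module R m" for k
    using xc by (auto simp: t_def free_module_def)
  have "k \<le> m \<Longrightarrow> f (t k) i = (\<Oplus>j\<in>{..<k}. f (unit_vector R m j) i \<otimes> x j)" for k
  proof (induction k)
    case 0
    have "t 0 = (\<lambda>i\<in>{..<m}. t 0 i \<otimes> \<zero>)"
      by (auto simp: t_def)
    hence "f (t 0) i = f (t 0) i \<otimes> \<zero>"
      using f_smult[OF t, of \<zero> 0] i by (metis lessThan_iff restrict_apply zero_closed)
    thus ?case
      using f_closed[OF t] by simp
  next
    case (Suc k)
    let ?y = "\<lambda>i\<in>{..<m}. unit_vector R m k i \<otimes> x k"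
    have y: "?y \<in> free_module R m"
      using xc[of k] Suc.prems e[of k] by (auto simp: free_module_def PiE_iff)
    have "t (Suc k) = (\<lambda>i\<in>{..<m}. t k i \<oplus> ?y i)"
      using xc xc[of k] Suc.prems by (auto simp: t_def unit_vector_def fun_eq_iff less_Suc_eq)
    hence "f (t (Suc k)) i = f (t k) i \<oplus> f ?y i"
      using f_add[OF t y] i by simp
    also have "f ?y i = f (unit_vector R m k) i \<otimes> x k"
      using f_smult[OF e xc, of k k] Suc.prems i by simp
    also have "f (t k) i = (\<Oplus>j\<in>{..<k}. f (unit_vector R m j) i \<otimes> x j)"
      using Suc by simp
    finally show ?case
      using f_closed[OF e] xc Suc.prems
      by (simp add: lessThan_Suc Pi_iff a_comm)
  qed
  moreover have "t m = x"
    using x by (auto simp: t_def free_module_def PiE_iff extensional_def fun_eq_iff)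
  ultimately show ?thesis
    by (metis order_refl)
qed

lemma right_module_iso_inverse:
  fixes R (structure)
  assumes "ring R" and f: "right_module_iso R m n f"
  shows "right_module_iso R n m (inv_into (free_module R m) f)" (is "right_module_iso R n m ?g")
  unfolding right_module_iso_def
proof (intro conjI ballI)
  interpret ring R by fact
  note f_iso = f[unfolded right_module_iso_def]
  have bij: "bij_betw f (free_module R m) (free_module R n)"
    using f_iso by blast
  show "bij_betw ?g (free_module R n) (free_module R m)"
    by (rule bij_betw_inv_into[OF bij])
  have g: "?g y \<in> free_module R m" "f (?g y) = y" if "y \<in> free_module R n" for y
    using bij that by (auto simp: bij_betw_def inv_into_into f_inv_into_f)
  have g_eq: "?g y = x" if "x \<in> free_module R m" "f x = y" for x y
    using bij that by (auto simp: bij_betw_def)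
  show "?g (\<lambda>i\<in>{..<n}. x i \<oplus> y i) = (\<lambda>i\<in>{..<m}. ?g x i \<oplus> ?g y i)"
    if xy: "x \<in> free_module R n" "y \<in> free_module R n" for x y
  proof (rule g_eq)
    show "(\<lambda>i\<in>{..<m}. ?g x i \<oplus> ?g y i) \<in> free_module R m"
      using g(1)[OF xy(1)] g(1)[OF xy(2)] by (auto simp: free_module_def PiE_iff)
    show "f (\<lambda>i\<in>{..<m}. ?g x i \<oplus> ?g y i) = (\<lambda>i\<in>{..<n}. x i \<oplus> y i)"
      using f_iso g[OF xy(1)] g[OF xy(2)] by simp
  qed
  show "?g (\<lambda>i\<in>{..<n}. x i \<otimes> r) = (\<lambda>i\<in>{..<m}. ?g x i \<otimes> r)"
    if xr: "x \<in> free_module R n" "r \<in> carrier R" for x r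
  proof (rule g_eq)
    show "(\<lambda>i\<in>{..<m}. ?g x i \<otimes> r) \<in> free_module R m"
      using g(1)[OF xr(1)] xr(2) by (auto simp: free_module_def PiE_iff)
    show "f (\<lambda>i\<in>{..<m}. ?g x i \<otimes> r) = (\<lambda>i\<in>{..<n}. x i \<otimes> r)"
      using f_iso g[OF xr(1)] xr(2) by simp
  qed
qed

lemma right_module_iso_matrices:
  fixes R (structure)
  assumes "ring R" and f: "right_module_iso R m n f"
  obtains M N where
    "\<And>i j. i < n \<Longrightarrow> j < m \<Longrightarrow> M i j \<in> carrier R" "\<And>i j. i < n \<Longrightarrow> j < m \<Longrightarrow> N j i \<in> carrier R"
    "\<And>i k. i < n \<Longrightarrow> k < n \<Longrightarrow> (\<Oplus>j\<in>{..<m}. M i j \<otimes> N j k) = (if i = k then \<one> else \<zero>)"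
    "\<And>i k. i < m \<Longrightarrow> k < m \<Longrightarrow> (\<Oplus>j\<in>{..<n}. N i j \<otimes> M j k) = (if i = k then \<one> else \<zero>)"
proof -
  interpret ring R by fact
  define g where "g = inv_into (free_module R m) f"
  have g: "right_module_iso R n m g"
    unfolding g_def by (rule right_module_iso_inverse[OF assms])
  have bij: "bij_betw f (free_module R m) (free_module R n)"
    "bij_betw g (free_module R n) (free_module R m)"
    using f g by (auto simp: right_module_iso_def)
  have e: "unit_vector R k j \<in> free_module R k" for j k
    by (auto simp: unit_vector_def free_module_def)
  have fe: "f (unit_vector R m j) \<in> free_module R n" "g (unit_vector R n j) \<in> free_module R m" for j
    using bij e by (blast dest: bij_betwE)+
  have fg: "f (g (unit_vector R n k)) = unit_vector R n k"
    "g (f (unit_vector R m k)) = unit_vector R m k" for k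
    using bij(1) e by (simp_all add: g_def bij_betw_inv_into_right bij_betw_inv_into_left)
  show ?thesis
  proof
    fix i j assume "i < n" "j < m"
    thus "f (unit_vector R m j) i \<in> carrier R" "g (unit_vector R n i) j \<in> carrier R"
      using fe by (auto simp: free_module_def PiE_iff)
  next
    fix i k assume "i < n" "k < n"
    thus "(\<Oplus>j\<in>{..<m}. f (unit_vector R m j) i \<otimes> g (unit_vector R n k) j)
        = (if i = k then \<one> else \<zero>)"
      using right_module_iso_expansion[OF \<open>ring R\<close> f fe(2)[of k], of i] fg(1)[of k]
      by (simp add: unit_vector_def)
  next
    fix i k assume "i < m" "k < m"
    thus "(\<Oplus>j\<in>{..<n}. g (unit_vector R n j) i \<otimes> f (unit_vector R m k) j)
        = (if i = k then \<one> else \<zero>)"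
      using right_module_iso_expansion[OF \<open>ring R\<close> g fe(1)[of k], of i] fg(2)[of k]
      by (simp add: unit_vector_def)
  qed
qed

section \<open>The corner ring\<close>

text \<open>The algebra and its corner have the operations of the ambient quotient ring but other carriers and
  units. Stating the lemma for every ring with this addition covers both.\<close>
lemma finsum_cl_class:
  fixes R :: "((('v, 'e) cl_gen, 'k::field) ncpoly set, 'm) ring_scheme"
  assumes G: "separated_graph G \<P>" "\<Lambda> \<subseteq> \<P>" and R: "ring R"
    and ops: "add R = add (free_algebra (cl_gens G) Quot cl_ideal G \<P> \<Lambda>)"
      "zero R = zero (free_algebra (cl_gens G) Quot cl_ideal G \<P> \<Lambda>)"
    and J: "finite J" "\<And>j. j \<in> J \<Longrightarrow> h j \<in> carrier (free_algebra (cl_gens G))"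
      "\<And>j. j \<in> J \<Longrightarrow> cl_class G \<P> \<Lambda> (h j) \<in> carrier R"
  shows "(\<Oplus>\<^bsub>R\<^esub>j\<in>J. cl_class G \<P> \<Lambda> (h j)) = cl_class G \<P> \<Lambda> (\<Sum>j\<in>J. h j)"
  using J
proof (induction J)
  case empty
  interpret R: ring R by (rule R)
  show ?case
    using ring_hom_zero[OF cl_class_hom[OF G, where 'k = 'k] ring_free_algebra
        ideal.quotient_is_ring[OF cl_ideal[OF G]]]
    by (simp add: ops) (simp add: free_algebra_def)
next
  case (insert j J)
  interpret R: ring R by (rule R)
  have "(\<Oplus>\<^bsub>R\<^esub>j\<in>insert j J. cl_class G \<P> \<Lambda> (h j))
      = cl_class G \<P> \<Lambda> (h j) \<oplus>\<^bsub>R\<^esub> cl_class G \<P> \<Lambda> (\<Sum>j\<in>J. h j)"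
    using insert by (subst R.finsum_insert) auto
  also have "\<dots> = cl_class G \<P> \<Lambda> (h j + (\<Sum>j\<in>J. h j))"
    using ring_hom_add[OF cl_class_hom[OF G, where 'k = 'k], of "h j" "\<Sum>j\<in>J. h j"] insert.prems
      free_algebra_closed(8)[of J h "cl_gens G"]
    by (simp add: ops) (simp add: free_algebra_def)
  finally show ?case
    using insert.hyps by simp
qed

theorem theorem18:
  fixes G :: "('v, 'e) pre_digraph"
    and \<P> \<Lambda> :: "'e set set"
    and L :: "(('v, 'e) cl_gen, 'k::field) ncpoly set ring"
    and H :: "'v set"
    and \<alpha> :: "(('v, 'e) cl_gen, 'k) ncpoly set"
  assumes "fin_digraph G"
    and "separated_graph G \<P>"
    and "\<Lambda> \<subseteq> \<P>"
    and "L = CL G \<P> \<Lambda>"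
    and "H \<subseteq> verts G"
    and "\<alpha> = (\<Oplus>\<^bsub>L\<^esub>v\<in>H. cl_vert G \<P> \<Lambda> v)"
    and "\<alpha> \<in> carrier L"
    and "\<alpha> \<otimes>\<^bsub>L\<^esub> \<alpha> = \<alpha>"
    and "(\<Sum>v\<in>H. vert_basis v)
           \<in> rat_space (Omega G \<P> \<Lambda>) - module.span rat_scale (block_vector G ` \<Lambda>)"
  shows "has_IBN (corner_ring L \<alpha>)"
  unfolding has_IBN_def
proof (intro conjI allI impI notI)
  note G = assms(1-3) and sep = assms(2,3)
  let ?A = "free_algebra (cl_gens G) :: (('v, 'e) cl_gen, 'k) ncpoly ring"
  let ?Q = "?A Quot cl_ideal G \<P> \<Lambda>"
  let ?c = "cl_class G \<P> \<Lambda> :: (('v, 'e) cl_gen, 'k) ncpoly \<Rightarrow> _"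
  let ?a = "vertex_sum H :: (('v, 'e) cl_gen, 'k) ncpoly"
  let ?R = "corner_ring L \<alpha>"
  have L: "ring L"
    using ring_CL[OF G] assms(4) by simp
  show R: "ring ?R"
    by (rule ring_corner_ring[OF L assms(7,8)])
  have ops: "add L = add ?Q" "zero L = zero ?Q" "mult L = mult ?Q"
    "carrier L = ?c ` free_algebra_plus (cl_gens G)"
    "add ?R = add ?Q" "zero ?R = zero ?Q" "mult ?R = mult ?Q" "one ?R = \<alpha>"
    by (simp_all add: assms(4) CL_def corner_ring_def)
  have H: "finite H"
    using assms(5) fin_digraph.finite_verts[OF assms(1)] finite_subset by blast
  have vert: "gen (Vert v) \<in> free_algebra_plus (cl_gens G)" if "v \<in> H" for v
    using assms(5) that
    by (auto simp: free_algebra_plus_def free_algebra_def gen_def zero_word_def cl_gens_def)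
  have plus_carrier: "p \<in> carrier ?A" if "p \<in> free_algebra_plus (cl_gens G)" for p
    using that by (simp add: free_algebra_plus_def)
  have a: "?a \<in> carrier ?A"
    unfolding vertex_sum_def using vert by (intro free_algebra_closed plus_carrier)
  have \<alpha>: "\<alpha> = ?c ?a"
    unfolding assms(6) cl_vert_def vertex_sum_def
    by (rule finsum_cl_class[OF sep L ops(1,2) H]) (use vert plus_carrier ops(4) in auto)
  have c_mult: "?c p \<otimes>\<^bsub>?Q\<^esub> ?c q = ?c (p * q)" if "p \<in> carrier ?A" "q \<in> carrier ?A" for p q
    using ring_hom_mult[OF cl_class_hom[OF sep, where 'k = 'k] that] by (simp add: free_algebra_def)
  have c_zero: "\<zero>\<^bsub>?Q\<^esub> = ?c 0"
    using ring_hom_zero[OF cl_class_hom[OF sep, where 'k = 'k] ring_free_algebra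
        ideal.quotient_is_ring[OF cl_ideal[OF sep]]]
    by (simp add: free_algebra_def)
  \<comment> \<open>An element \<open>\<alpha> y \<alpha>\<close> of the corner is represented by a polynomial with left factor \<open>?a\<close>; this
    is the form required for the matrices to act within the points over \<open>H\<close>.\<close>
  have lift: "\<exists>p. ?a * p \<in> carrier ?A \<and> x = ?c (?a * p)" if x: "x \<in> carrier ?R" for x
  proof -
    obtain y where y: "y \<in> carrier L" "x = \<alpha> \<otimes>\<^bsub>L\<^esub> y \<otimes>\<^bsub>L\<^esub> \<alpha>"
      using x by (auto simp: corner_ring_def)
    then obtain q where "q \<in> carrier ?A" "y = ?c q"
      using plus_carrier by (auto simp: ops(4))
    with y a show ?thesis
      by (intro exI[of _ "q * ?a"])
        (simp add: \<alpha> ops(3) c_mult free_algebra_closed mult.assoc)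
  qed
  have lift_matrix: "\<exists>M. \<forall>i j. i < k \<and> j < l \<longrightarrow>
      (\<exists>p. M i j = ?a * p) \<and> M i j \<in> carrier ?A \<and> X i j = ?c (M i j)"
    if "\<And>i j. i < k \<Longrightarrow> j < l \<Longrightarrow> X i j \<in> carrier ?R" for k l :: nat and X
  proof -
    have "\<forall>i j. \<exists>q. i < k \<and> j < l \<longrightarrow> (\<exists>p. q = ?a * p) \<and> q \<in> carrier ?A \<and> X i j = ?c q"
      using lift that by blast
    thus ?thesis
      by metis
  qed
  have in_ideal: "(\<Sum>j<l. M i j * N j k) - (if i = k then ?a else 0) \<in> cl_ideal G \<P> \<Lambda>"
    if MN: "\<And>j. j < l \<Longrightarrow> M i j \<in> carrier ?A" "\<And>j. j < l \<Longrightarrow> N j k \<in> carrier ?A"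
      "\<And>j. j < l \<Longrightarrow> ?c (M i j) \<in> carrier ?R" "\<And>j. j < l \<Longrightarrow> ?c (N j k) \<in> carrier ?R"
      "(\<Oplus>\<^bsub>?R\<^esub>j\<in>{..<l}. ?c (M i j) \<otimes>\<^bsub>?R\<^esub> ?c (N j k)) = (if i = k then \<one>\<^bsub>?R\<^esub> else \<zero>\<^bsub>?R\<^esub>)"
    for i k l :: nat and M N
  proof -
    interpret R: ring ?R by (rule R)
    have mult: "?c (M i j) \<otimes>\<^bsub>?R\<^esub> ?c (N j k) = ?c (M i j * N j k)" if "j < l" for j
      using MN(1,2)[OF that] by (simp add: ops(7) c_mult)
    have "?c (\<Sum>j<l. M i j * N j k) = (\<Oplus>\<^bsub>?R\<^esub>j\<in>{..<l}. ?c (M i j * N j k))"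
      using MN mult R.m_closed
      by (intro finsum_cl_class[OF sep R ops(5,6), symmetric])
        (auto simp: free_algebra_closed simp flip: mult)
    also have "\<dots> = (\<Oplus>\<^bsub>?R\<^esub>j\<in>{..<l}. ?c (M i j) \<otimes>\<^bsub>?R\<^esub> ?c (N j k))"
      using MN by (intro R.finsum_cong') (auto simp: mult)
    also have "\<dots> = ?c (if i = k then ?a else 0)"
      unfolding MN(5) ops(6,8) c_zero by (simp add: \<alpha>)
    finally show ?thesis
      using a MN(1,2)
      by (subst (asm) cl_class_eq_iff[OF sep]) (auto intro!: free_algebra_closed)
  qed
  fix m n :: nat
  assume mn: "0 < m \<and> 0 < n \<and> m \<noteq> n" and "\<exists>f. right_module_iso ?R m n f"
  then obtain f where f: "right_module_iso ?R m n f"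
    by blast
  obtain X Y where XY: "\<And>i j. i < n \<Longrightarrow> j < m \<Longrightarrow> X i j \<in> carrier ?R"
      "\<And>i j. i < n \<Longrightarrow> j < m \<Longrightarrow> Y j i \<in> carrier ?R"
      "\<And>i k. i < n \<Longrightarrow> k < n \<Longrightarrow>
        (\<Oplus>\<^bsub>?R\<^esub>j\<in>{..<m}. X i j \<otimes>\<^bsub>?R\<^esub> Y j k) = (if i = k then \<one>\<^bsub>?R\<^esub> else \<zero>\<^bsub>?R\<^esub>)"
      "\<And>i k. i < m \<Longrightarrow> k < m \<Longrightarrow>
        (\<Oplus>\<^bsub>?R\<^esub>j\<in>{..<n}. Y i j \<otimes>\<^bsub>?R\<^esub> X j k) = (if i = k then \<one>\<^bsub>?R\<^esub> else \<zero>\<^bsub>?R\<^esub>)"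
    by (rule right_module_iso_matrices[OF R f]) blast
  obtain M where M: "\<And>i j. i < n \<Longrightarrow> j < m \<Longrightarrow> \<exists>p. M i j = ?a * p"
      "\<And>i j. i < n \<Longrightarrow> j < m \<Longrightarrow> M i j \<in> carrier ?A" "\<And>i j. i < n \<Longrightarrow> j < m \<Longrightarrow> X i j = ?c (M i j)"
    using lift_matrix[of n m X, OF XY(1)] by blast
  obtain N where N: "\<And>j i. j < m \<Longrightarrow> i < n \<Longrightarrow> \<exists>p. N j i = ?a * p"
      "\<And>j i. j < m \<Longrightarrow> i < n \<Longrightarrow> N j i \<in> carrier ?A" "\<And>j i. j < m \<Longrightarrow> i < n \<Longrightarrow> Y j i = ?c (N j i)"
    using lift_matrix[of m n Y, OF XY(2)] by blast
  interpret R: ring ?R by (rule R)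
  have MN: "(\<Sum>j<m. M i j * N j k) - (if i = k then ?a else 0) \<in> cl_ideal G \<P> \<Lambda>"
    if "i < n" "k < n" for i k
  proof (rule in_ideal)
    show "(\<Oplus>\<^bsub>?R\<^esub>j\<in>{..<m}. ?c (M i j) \<otimes>\<^bsub>?R\<^esub> ?c (N j k)) = (if i = k then \<one>\<^bsub>?R\<^esub> else \<zero>\<^bsub>?R\<^esub>)"
      unfolding XY(3)[OF that, symmetric]
      by (rule R.finsum_cong') (use that M(3) N(3) XY(1,2) in auto)
  qed (use that M N XY(1,2) in \<open>simp_all flip: M(3) N(3)\<close>)
  have NM: "(\<Sum>j<n. N i j * M j k) - (if i = k then ?a else 0) \<in> cl_ideal G \<P> \<Lambda>"
    if "i < m" "k < m" for i k
  proof (rule in_ideal)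
    show "(\<Oplus>\<^bsub>?R\<^esub>j\<in>{..<n}. ?c (N i j) \<otimes>\<^bsub>?R\<^esub> ?c (M j k)) = (if i = k then \<one>\<^bsub>?R\<^esub> else \<zero>\<^bsub>?R\<^esub>)"
      unfolding XY(4)[OF that, symmetric]
      by (rule R.finsum_cong') (use that M(3) N(3) XY(1,2) in auto)
  qed (use that M N XY(1,2) in \<open>simp_all flip: M(3) N(3)\<close>)
  obtain \<phi> :: "'v \<Rightarrow> int" where
    \<phi>: "\<And>X. X \<in> \<Lambda> \<Longrightarrow> \<phi> (block_source G X) = (\<Sum>e\<in>X. \<phi> (head G e))" "(\<Sum>v\<in>H. \<phi> v) \<noteq> 0"
    using integral_functional[OF G assms(5)] assms(9) by blast
  have "int m * (\<Sum>v\<in>H. \<phi> v) = int n * (\<Sum>v\<in>H. \<phi> v)"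
    by (rule corner_matrices_index[OF G H \<phi>(1) M(1) N(1) MN NM])
  thus False
    using \<phi>(2) mn by simp
qed

end
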